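(* In IITT, if $\Gamma\vdash t:T$ then there is a weak head normal form $a$ with $t\searrow a$ and $\Gamma\vdash t=a:T$.
   Context: Irrelevant Intensional Type Theory (IITT) is defined as follows. Sorts are $\mathsf{Set}_k$ ($k\in\mathbb{N}$), with $\mathsf{Axiom}=\{(\mathsf{Set}_i,\mathsf{Set}_{i+1})\mid i\in\mathbb{N}\}$ and $\mathsf{Rule}=\{(\mathsf{Set}_i,\mathsf{Set}_j,\mathsf{Set}_{\max(i,j)})\mid i,j\in\mathbb{N}\}$. Annotations are $\star\in\{:,\div\}$ (relevant, irrelevant). Expressions: $t,u,T,U ::= s \mid (x\star U)\to^{s,s'}T \mid x \mid \lambda x\star U.\,t \mid t\star u$, where $(x\star U)\to^{s,s'}T$ is a relevant or irrelevant dependent function type annotated with the sort $s$ of its domain and $s'$ of its codomain, and $t\star u$ is relevant application (also written $t\,u$) or irrelevant application $t\div u$. Expressions are taken modulo $\alpha$-equivalence; $[u/x]t$ is capture-avoiding substitution. Contexts: $\Gamma ::= () \mid \Gamma.\,x\star T$ (variables distinct). Resurrection $\Gamma^{\oplus}$ replaces each binding $x\div T$ by $x:T$. Abbreviations: $\Gamma\vdash t\div T$ means $\Gamma^\oplus\vdash t:T$; $\Gamma\vdash t=t'\div T$ means $\Gamma\vdash t\div T$ and $\Gamma\vdash t'\div T$; $\Gamma\vdash T$ means $\Gamma\vdash T:s$ for some sort $s$; $\Gamma\vdash T=T'$ means $\Gamma\vdash T=T':s$ for some $s$. The judgements $\vdash\Gamma$, $\Gamma\vdash t:T$, $\Gamma\vdash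 t=t':T$ are defined mutually inductively by: (contexts) $\vdash()$; from $\vdash\Gamma$ and $\Gamma\vdash T$ infer $\vdash\Gamma.x\star T$. (typing) from $\vdash\Gamma$, $(s,s')\in\mathsf{Axiom}$ infer $\Gamma\vdash s:s'$; from $\Gamma\vdash U:s_1$, $\Gamma.x\star U\vdash T:s_2$, $(s_1,s_2,s_3)\in\mathsf{Rule}$ infer $\Gamma\vdash (x\star U)\to^{s_1,s_2}T:s_3$; from $\vdash\Gamma$ and $(x:U)\in\Gamma$ infer $\Gamma\vdash x:U$ (no variable rule for irrelevant bindings); from $\Gamma.x\star U\vdash t:T$ and $\Gamma\vdash (x\star U)\to^{s,s'}T$ infer $\Gamma\vdash \lambda x\star U.t:(x\star U)\to^{s,s'}T$; from $\Gamma\vdash t:(x\star U)\to^{s,s'}T$ and $\Gamma\vdash u\star U$ infer $\Gamma\vdash t\star u:[u/x]T$; from $\Gamma\vdash t:T$ and $\Gamma\vdash T=T'$ infer $\Gamma\vdash t:T'$. (equality) $\beta$: from $\Gamma.x\star U\vdash t:T$ and $\Gamma\vdash u\star U$ infer $\Gamma\vdash(\lambda x\star U.t)\star u=[u/x]t:[u/x]T$; $\eta$: from $\Gamma\vdash t:(x\star U)\to^{s,s'}T$ infer $\Gamma\vdash t=\lambda x\star U.(t\star x):(x\star U)\to^{s,s'}T$; reflexivity, symmetry, transitivity; from $\Gamma\vdash U=U':s_1$, $\Gamma.x\star U\vdash T=T':s_2$, $(s_1,s_2,s_3)\in\mathsf{Rule}$ infer $\Gamma\vdash (x\star U)\to^{s_1,s_2}T=(x\star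 U')\to^{s_1,s_2}T':s_3$; from $\Gamma\vdash U=U':s_1$, $\Gamma.x\star U\vdash T:s_2$, $\Gamma.x\star U\vdash t=t':T$ infer $\Gamma\vdash\lambda x\star U.t=\lambda x\star U'.t':(x\star U)\to^{s_1,s_2}T$; from $\Gamma\vdash t=t':(x\star U)\to^{s,s'}T$ and $\Gamma\vdash u=u'\star U$ infer $\Gamma\vdash t\star u=t'\star u':[u/x]T$; from $\Gamma\vdash t=t':T$ and $\Gamma\vdash T=T'$ infer $\Gamma\vdash t=t':T'$. Weak head normal forms: $a ::= s\mid (x\star U)\to^{s,s'}T\mid \lambda x\star U.t\mid n$, with neutrals $n ::= x\mid n\star u$. Weak head evaluation $t\searrow a$ and active application $f\,@^\star u\searrow a$ are defined by: $a\searrow a$ for a whnf $a$; if $t\searrow f$ and $f\,@^\star u\searrow a$ then $t\star u\searrow a$; if $[u/x]t\searrow a$ then $(\lambda x\star U.t)\,@^\star u\searrow a$; $n\,@^\star u\searrow n\star u$ for neutral $n$. *)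

theory Defs
  imports Main
begin

text \<open>
  Expressions modulo alpha-equivalence are represented with de Bruijn indices: the codomain of a
  function type and the body of an abstraction bind index 0.
\<close>

datatype ann = Rel | Irr

datatype usort = Set nat

definition Axiom :: "(usort \<times> usort) set" where
  "Axiom = {(Set i, Set (Suc i)) | i. True}"

definition Rule :: "(usort \<times> usort \<times> usort) set" where
  "Rule = {(Set i, Set j, Set (max i j)) | i j. True}"

text \<open>
  \<open>Pi r U s s' T\<close> is the function type from \<open>U\<close>, with domain annotation \<open>r\<close>, to \<open>T\<close>, decorated
  with the sorts \<open>s\<close> of \<open>U\<close> and \<open>s'\<close> of \<open>T\<close>.
\<close>

datatype expr =
    Sort usort
  | Pi ann expr usort usort expr
  | Var nat
  | Lam ann expr expr
  | App ann expr expr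

fun up_ren :: "(nat \<Rightarrow> nat) \<Rightarrow> nat \<Rightarrow> nat" where
  "up_ren \<xi> 0 = 0"
| "up_ren \<xi> (Suc i) = Suc (\<xi> i)"

primrec rename :: "(nat \<Rightarrow> nat) \<Rightarrow> expr \<Rightarrow> expr" where
  "rename \<xi> (Sort s) = Sort s"
| "rename \<xi> (Pi r U s s' T) = Pi r (rename \<xi> U) s s' (rename (up_ren \<xi>) T)"
| "rename \<xi> (Var i) = Var (\<xi> i)"
| "rename \<xi> (Lam r U t) = Lam r (rename \<xi> U) (rename (up_ren \<xi>) t)"
| "rename \<xi> (App r t u) = App r (rename \<xi> t) (rename \<xi> u)"

abbreviation wk :: "nat \<Rightarrow> expr \<Rightarrow> expr" where
  "wk n \<equiv> rename (\<lambda>i. i + n)"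

fun up_subst :: "(nat \<Rightarrow> expr) \<Rightarrow> nat \<Rightarrow> expr" where
  "up_subst \<sigma> 0 = Var 0"
| "up_subst \<sigma> (Suc i) = wk 1 (\<sigma> i)"

primrec subst :: "(nat \<Rightarrow> expr) \<Rightarrow> expr \<Rightarrow> expr" where
  "subst \<sigma> (Sort s) = Sort s"
| "subst \<sigma> (Pi r U s s' T) = Pi r (subst \<sigma> U) s s' (subst (up_subst \<sigma>) T)"
| "subst \<sigma> (Var i) = \<sigma> i"
| "subst \<sigma> (Lam r U t) = Lam r (subst \<sigma> U) (subst (up_subst \<sigma>) t)"
| "subst \<sigma> (App r t u) = App r (subst \<sigma> t) (subst \<sigma> u)"

text \<open>
  \<open>t\<langle>u\<rangle>\<close> substitutes \<open>u\<close> for the most recently bound variable, that is, index 0;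
  the other indices decrease by one because that binder disappears.
\<close>

definition subst1 :: "expr \<Rightarrow> expr \<Rightarrow> expr" (\<open>_\<langle>_\<rangle>\<close> [1000, 0] 1000) where
  "t\<langle>u\<rangle> = subst (\<lambda>i. case i of 0 \<Rightarrow> u | Suc j \<Rightarrow> Var j) t"

text \<open>
  The head of a context is its most recent binding, the one of index 0. The type stored at
  position \<open>i\<close> lives in the remaining context \<open>drop (Suc i) \<Gamma>\<close>, hence the weakening in the
  variable rule below.
\<close>

type_synonym ctx = "(ann \<times> expr) list"

definition resurrect :: "ctx \<Rightarrow> ctx" (\<open>_\<^sup>\<oplus>\<close> [1000] 1000) where
  "\<Gamma>\<^sup>\<oplus> = map (\<lambda>(r, T). (Rel, T)) \<Gamma>"

text \<open>
  The context in which the subject of a judgement with annotation \<open>r\<close> is typed: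
  \<open>ann_ctx r \<Gamma> \<turnstile> u : U\<close> is \<open>\<Gamma> \<turnstile> u : U\<close> for \<open>r = Rel\<close>, and its irrelevant counterpart
  \<open>\<Gamma>\<^sup>\<oplus> \<turnstile> u : U\<close> for \<open>r = Irr\<close>.
\<close>

fun ann_ctx :: "ann \<Rightarrow> ctx \<Rightarrow> ctx" where
  "ann_ctx Rel \<Gamma> = \<Gamma>"
| "ann_ctx Irr \<Gamma> = \<Gamma>\<^sup>\<oplus>"

text \<open>
  The congruence rule for application is split by annotation, since an irrelevant equality of
  arguments only says that both sides are well-typed in the resurrected context.
\<close>

inductive wf_ctx :: "ctx \<Rightarrow> bool" (\<open>\<turnstile> _\<close> [51] 50)
  and has_type :: "ctx \<Rightarrow> expr \<Rightarrow> expr \<Rightarrow> bool" (\<open>_ \<turnstile> _ : _\<close> [51, 51, 51] 50)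
  and eq_type :: "ctx \<Rightarrow> expr \<Rightarrow> expr \<Rightarrow> expr \<Rightarrow> bool" (\<open>_ \<turnstile> _ = _ : _\<close> [51, 51, 51, 51] 50)
where
  wf_empty: "\<turnstile> []"
| wf_ext: "\<turnstile> \<Gamma> \<Longrightarrow> \<Gamma> \<turnstile> T : Sort s \<Longrightarrow> \<turnstile> (r, T) # \<Gamma>"

| ty_sort: "\<turnstile> \<Gamma> \<Longrightarrow> (s, s') \<in> Axiom \<Longrightarrow> \<Gamma> \<turnstile> Sort s : Sort s'"
| ty_pi: "\<Gamma> \<turnstile> U : Sort s1 \<Longrightarrow> (r, U) # \<Gamma> \<turnstile> T : Sort s2 \<Longrightarrow> (s1, s2, s3) \<in> Rule \<Longrightarrow>
    \<Gamma> \<turnstile> Pi r U s1 s2 T : Sort s3"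
| ty_var: "\<turnstile> \<Gamma> \<Longrightarrow> i < length \<Gamma> \<Longrightarrow> \<Gamma> ! i = (Rel, U) \<Longrightarrow> \<Gamma> \<turnstile> Var i : wk (Suc i) U"
| ty_lam: "(r, U) # \<Gamma> \<turnstile> t : T \<Longrightarrow> \<Gamma> \<turnstile> Pi r U s s' T : Sort s'' \<Longrightarrow>
    \<Gamma> \<turnstile> Lam r U t : Pi r U s s' T"
| ty_app: "\<Gamma> \<turnstile> t : Pi r U s s' T \<Longrightarrow> ann_ctx r \<Gamma> \<turnstile> u : U \<Longrightarrow> \<Gamma> \<turnstile> App r t u : T\<langle>u\<rangle>"
| ty_conv: "\<Gamma> \<turnstile> t : T \<Longrightarrow> \<Gamma> \<turnstile> T = T' : Sort s \<Longrightarrow> \<Gamma> \<turnstile> t : T'"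

| eq_beta: "(r, U) # \<Gamma> \<turnstile> t : T \<Longrightarrow> ann_ctx r \<Gamma> \<turnstile> u : U \<Longrightarrow>
    \<Gamma> \<turnstile> App r (Lam r U t) u = t\<langle>u\<rangle> : T\<langle>u\<rangle>"
| eq_eta: "\<Gamma> \<turnstile> t : Pi r U s s' T \<Longrightarrow>
    \<Gamma> \<turnstile> t = Lam r U (App r (wk 1 t) (Var 0)) : Pi r U s s' T"
| eq_refl: "\<Gamma> \<turnstile> t : T \<Longrightarrow> \<Gamma> \<turnstile> t = t : T"
| eq_sym: "\<Gamma> \<turnstile> t = t' : T \<Longrightarrow> \<Gamma> \<turnstile> t' = t : T"
| eq_trans: "\<Gamma> \<turnstile> t1 = t2 : T \<Longrightarrow> \<Gamma> \<turnstile> t2 = t3 : T \<Longrightarrow> \<Gamma> \<turnstile> t1 = t3 : T"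
| eq_pi: "\<Gamma> \<turnstile> U = U' : Sort s1 \<Longrightarrow> (r, U) # \<Gamma> \<turnstile> T = T' : Sort s2 \<Longrightarrow> (s1, s2, s3) \<in> Rule \<Longrightarrow>
    \<Gamma> \<turnstile> Pi r U s1 s2 T = Pi r U' s1 s2 T' : Sort s3"
| eq_lam: "\<Gamma> \<turnstile> U = U' : Sort s1 \<Longrightarrow> (r, U) # \<Gamma> \<turnstile> T : Sort s2 \<Longrightarrow> (r, U) # \<Gamma> \<turnstile> t = t' : T \<Longrightarrow>
    \<Gamma> \<turnstile> Lam r U t = Lam r U' t' : Pi r U s1 s2 T"
| eq_app_rel: "\<Gamma> \<turnstile> t = t' : Pi Rel U s s' T \<Longrightarrow> \<Gamma> \<turnstile> u = u' : U \<Longrightarrow>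
    \<Gamma> \<turnstile> App Rel t u = App Rel t' u' : T\<langle>u\<rangle>"
| eq_app_irr: "\<Gamma> \<turnstile> t = t' : Pi Irr U s s' T \<Longrightarrow> \<Gamma>\<^sup>\<oplus> \<turnstile> u : U \<Longrightarrow> \<Gamma>\<^sup>\<oplus> \<turnstile> u' : U \<Longrightarrow>
    \<Gamma> \<turnstile> App Irr t u = App Irr t' u' : T\<langle>u\<rangle>"
| eq_conv: "\<Gamma> \<turnstile> t = t' : T \<Longrightarrow> \<Gamma> \<turnstile> T = T' : Sort s \<Longrightarrow> \<Gamma> \<turnstile> t = t' : T'"

inductive neutral :: "expr \<Rightarrow> bool" where
  "neutral (Var i)"
| "neutral n \<Longrightarrow> neutral (App r n u)"

inductive whnf :: "expr \<Rightarrow> bool" where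
  "whnf (Sort s)"
| "whnf (Pi r U s s' T)"
| "whnf (Lam r U t)"
| "neutral n \<Longrightarrow> whnf n"

inductive whe :: "expr \<Rightarrow> expr \<Rightarrow> bool" (\<open>_ \<Down> _\<close> [51, 51] 50)
  and act_app :: "expr \<Rightarrow> ann \<Rightarrow> expr \<Rightarrow> expr \<Rightarrow> bool" (\<open>_ @\<^bsup>_\<^esup> _ \<Down> _\<close> [66, 0, 66, 51] 50)
where
  whe_whnf: "whnf a \<Longrightarrow> a \<Down> a"
| whe_app: "t \<Down> f \<Longrightarrow> f @\<^bsup>r\<^esup> u \<Down> a \<Longrightarrow> App r t u \<Down> a"
| act_lam: "t\<langle>u\<rangle> \<Down> a \<Longrightarrow> Lam r U t @\<^bsup>r\<^esup> u \<Down> a"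
| act_ne: "neutral n \<Longrightarrow> n @\<^bsup>r\<^esup> u \<Down> App r n u"

end

theory Submission
  imports Defs
begin

text \<open>
  The proof is by a logical relation in the style of Tait: reducible types are paired with partial
  equivalence relations on their elements, by recursion on the universe level. Weak head evaluation never goes
  under a binder, so no Kripke quantification over extended contexts is needed: everything
  lives in one fixed context \<open>D\<close>, and irrelevant arguments, which are never evaluated, are only
  required to be well-typed in \<open>D\<^sup>\<oplus>\<close>. The relations contain the judgemental equalities
  \<open>D \<turnstile> t = a : T\<close> between a term and its weak head normal form. These are built up from the equality
  rules, so subject reduction, and with it injectivity of function types, is not needed.
\<close>

section \<open>Substitution calculus\<close>

text \<open>Fixing \<open>D\<close> has a price. Equality of two abstractions or function types is a
  statement under a binder and cannot be recovered from its instances at arguments typed in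
  \<open>D\<close>; nor can a function be applied to a fresh variable to learn that it evaluates. So
  function types and functions carry their judgemental equality and their evaluation as explicit
  data, and the syntax has to supply these equalities for two different substitutions into
  \<open>D\<close> before any reducibility argument starts. This is functionality, and it rests on
  syntactic validity. Any two irrelevant arguments must yield the same relation on the codomain.
  This can hold because environments constrain irrelevant entries by typing alone, and because no
  variable rule gives access to an irrelevant binding. The sorts written on a function type keep the
  levels of its domain and codomain at most its own, and the universe \<open>univ j\<close> is met
  only at level \<open>Suc j\<close>; the recursion on levels rests on this. In the end
  \<open>D\<close> is the context of the given judgement, and every variable, being neutral, is
  interpreted by itself.\<close>

lemma up_ren_comp: "up_ren \<xi> \<circ> up_ren \<zeta> = up_ren (\<xi> \<circ> \<zeta>)"
proof
  show "(up_ren \<xi> \<circ> up_ren \<zeta>) i = up_ren (\<xi> \<circ> \<zeta>) i" for i by (cases i) auto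
qed

lemma rename_rename: "rename \<xi> (rename \<zeta> t) = rename (\<xi> \<circ> \<zeta>) t"
  by (induction t arbitrary: \<xi> \<zeta>) (auto simp: up_ren_comp)

lemma up_subst_up_ren: "up_subst \<sigma> \<circ> up_ren \<xi> = up_subst (\<sigma> \<circ> \<xi>)"
proof
  show "(up_subst \<sigma> \<circ> up_ren \<xi>) i = up_subst (\<sigma> \<circ> \<xi>) i" for i by (cases i) auto
qed

lemma subst_rename: "subst \<sigma> (rename \<xi> t) = subst (\<sigma> \<circ> \<xi>) t"
  by (induction t arbitrary: \<sigma> \<xi>) (auto simp: up_subst_up_ren)

lemma rename_up_subst: "rename (up_ren \<xi>) \<circ> up_subst \<sigma> = up_subst (rename \<xi> \<circ> \<sigma>)"
proof
  show "(rename (up_ren \<xi>) \<circ> up_subst \<sigma>) i = up_subst (rename \<xi> \<circ> \<sigma>) i" for i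
    by (cases i) (auto simp: rename_rename comp_def)
qed

lemma rename_subst: "rename \<xi> (subst \<sigma> t) = subst (rename \<xi> \<circ> \<sigma>) t"
  by (induction t arbitrary: \<sigma> \<xi>) (auto simp: rename_up_subst)

lemma up_subst_comp: "subst (up_subst \<tau>) \<circ> up_subst \<sigma> = up_subst (subst \<tau> \<circ> \<sigma>)"
proof
  show "(subst (up_subst \<tau>) \<circ> up_subst \<sigma>) i = up_subst (subst \<tau> \<circ> \<sigma>) i" for i
    by (cases i) (auto simp: subst_rename rename_subst comp_def)
qed

lemma subst_subst: "subst \<tau> (subst \<sigma> t) = subst (subst \<tau> \<circ> \<sigma>) t"
  by (induction t arbitrary: \<sigma> \<tau>) (auto simp: up_subst_comp)

lemma up_subst_Var: "up_subst Var = Var"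
proof
  show "up_subst Var i = Var i" for i by (cases i) auto
qed

lemma subst_Var: "subst Var t = t"
  by (induction t) (auto simp: up_subst_Var)

lemma up_subst_ren: "up_subst (Var \<circ> \<xi>) = Var \<circ> up_ren \<xi>"
proof
  show "up_subst (Var \<circ> \<xi>) i = (Var \<circ> up_ren \<xi>) i" for i by (cases i) auto
qed

lemma rename_eq_subst: "rename \<xi> t = subst (Var \<circ> \<xi>) t"
  by (induction t arbitrary: \<xi>) (auto simp: up_subst_ren)

lemma subst1_eq: "t\<langle>u\<rangle> = subst (case_nat u Var) t"
  unfolding subst1_def by simp

text \<open>The bridge between syntax and environments: semantic environments grow as
  \<open>case_nat u \<sigma>\<close>, whereas \<beta>-reduction of a substituted abstraction
  produces the left-hand side.\<close>

lemma subst_up_subst1: "(subst (up_subst \<sigma>) t)\<langle>u\<rangle> = subst (case_nat u \<sigma>) t"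
proof -
  have "subst (case_nat u Var) \<circ> up_subst \<sigma> = case_nat u \<sigma>"
  proof
    show "(subst (case_nat u Var) \<circ> up_subst \<sigma>) i = case_nat u \<sigma> i" for i
      by (cases i) (auto simp: subst_rename comp_def subst_Var)
  qed
  then show ?thesis by (simp add: subst1_eq subst_subst)
qed

lemma subst_subst1: "subst \<sigma> (t\<langle>u\<rangle>) = subst (case_nat (subst \<sigma> u) \<sigma>) t"
proof -
  have "subst \<sigma> \<circ> case_nat u Var = case_nat (subst \<sigma> u) \<sigma>"
  proof
    show "(subst \<sigma> \<circ> case_nat u Var) i = case_nat (subst \<sigma> u) \<sigma> i" for i
      by (cases i) auto
  qed
  then show ?thesis by (simp add: subst1_eq subst_subst)
qed

lemma subst_subst1_up: "subst \<sigma> (t\<langle>u\<rangle>) = (subst (up_subst \<sigma>) t)\<langle>subst \<sigma> u\<rangle>"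
  by (simp add: subst_up_subst1 subst_subst1)

lemma subst_wk: "subst \<sigma> (wk n t) = subst (\<lambda>i. \<sigma> (i + n)) t"
  by (simp add: subst_rename comp_def)

lemma subst_up_wk: "subst (up_subst \<sigma>) (wk 1 t) = wk 1 (subst \<sigma> t)"
  by (simp add: subst_rename rename_subst comp_def)

lemma wk_1_wk: "wk 1 (wk n t) = wk (Suc n) t"
  by (simp add: rename_rename comp_def)

section \<open>Upgrading irrelevant bindings\<close>

text \<open>A relation rather than the map to the resurrected context: an induction that enters a
  binder keeps the annotation of that binder, so the contexts it meets are resurrected only in
  part.\<close>

definition upgrade :: "ctx \<Rightarrow> ctx \<Rightarrow> bool" where
  "upgrade = list_all2 (\<lambda>(r, U) (r', U'). U = U' \<and> (r = Rel \<longrightarrow> r' = Rel))"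

lemma upgrade_Nil: "upgrade [] \<Gamma>' \<longleftrightarrow> \<Gamma>' = []"
  by (simp add: upgrade_def)

lemma upgrade_Cons: "upgrade ((r, U) # \<Gamma>) \<Gamma>' \<longleftrightarrow>
    (\<exists>r' \<Gamma>''. \<Gamma>' = (r', U) # \<Gamma>'' \<and> (r = Rel \<longrightarrow> r' = Rel) \<and> upgrade \<Gamma> \<Gamma>'')"
  by (auto simp: upgrade_def list_all2_Cons1)

lemma upgrade_lift: "upgrade \<Gamma> \<Gamma>' \<Longrightarrow> upgrade ((r, U) # \<Gamma>) ((r, U) # \<Gamma>')"
  by (simp add: upgrade_Cons)

lemma upgrade_refl: "upgrade \<Gamma> \<Gamma>"
  by (auto simp: upgrade_def intro: list_all2_refl)

lemma upgrade_resurrect: "upgrade \<Gamma> (\<Gamma>\<^sup>\<oplus>)"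
  by (auto simp: upgrade_def resurrect_def list_all2_conv_all_nth split: prod.splits)

lemma upgrade_ann_ctx: "upgrade \<Gamma> (ann_ctx r \<Gamma>)"
  by (cases r) (auto simp: upgrade_refl upgrade_resurrect)

lemma upgrade_resurrect_mono: "upgrade \<Gamma> \<Gamma>' \<Longrightarrow> upgrade (\<Gamma>\<^sup>\<oplus>) (\<Gamma>'\<^sup>\<oplus>)"
  by (auto simp: upgrade_def resurrect_def list_all2_conv_all_nth split: prod.splits)

lemma upgrade_ann_ctx_mono: "upgrade \<Gamma> \<Gamma>' \<Longrightarrow> upgrade (ann_ctx r \<Gamma>) (ann_ctx r \<Gamma>')"
  by (cases r) (auto simp: upgrade_resurrect_mono)

lemma upgrade_nth: "upgrade \<Gamma> \<Gamma>' \<Longrightarrow> i < length \<Gamma> \<Longrightarrow> \<Gamma> ! i = (Rel, U) \<Longrightarrow>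
    i < length \<Gamma>' \<and> \<Gamma>' ! i = (Rel, U)"
  unfolding upgrade_def list_all2_conv_all_nth by (cases "\<Gamma>' ! i") auto

text \<open>The variable rule is the only one that inspects an annotation in the context, and it
  asks for \<open>Rel\<close>, which upgrading preserves. Premises in a resurrected context are
  covered by monotonicity of resurrection.\<close>

lemma upgrade_typing:
  "\<turnstile> \<Gamma> \<Longrightarrow> upgrade \<Gamma> \<Gamma>' \<Longrightarrow> \<turnstile> \<Gamma>'"
  "\<Gamma> \<turnstile> t : T \<Longrightarrow> upgrade \<Gamma> \<Gamma>' \<Longrightarrow> \<Gamma>' \<turnstile> t : T"
  "\<Gamma> \<turnstile> t = t' : T \<Longrightarrow> upgrade \<Gamma> \<Gamma>' \<Longrightarrow> \<Gamma>' \<turnstile> t = t' : T"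
proof (induction arbitrary: \<Gamma>' and \<Gamma>' and \<Gamma>' rule: wf_ctx_has_type_eq_type.inducts)
  case wf_empty
  then show ?case by (simp add: upgrade_Nil wf_ctx_has_type_eq_type.wf_empty)
next
  case (wf_ext \<Gamma> T s r)
  then show ?case by (auto simp: upgrade_Cons intro: wf_ctx_has_type_eq_type.wf_ext)
next
  case (ty_sort \<Gamma> s s')
  then show ?case by (blast intro: wf_ctx_has_type_eq_type.ty_sort)
next
  case (ty_pi \<Gamma> U s1 r T s2 s3)
  then show ?case by (meson upgrade_lift wf_ctx_has_type_eq_type.ty_pi)
next
  case (ty_var \<Gamma> i U)
  note \<Gamma>' = upgrade_nth[OF ty_var.prems ty_var.hyps(2,3)]
  show ?case
    by (rule wf_ctx_has_type_eq_type.ty_var[OF _ conjunct1[OF \<Gamma>'] conjunct2[OF \<Gamma>']])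
      (rule ty_var.IH[OF ty_var.prems])
next
  case (ty_lam r U \<Gamma> t T s s' s'')
  then show ?case by (meson upgrade_lift wf_ctx_has_type_eq_type.ty_lam)
next
  case (ty_app \<Gamma> t r U s s' T u)
  then show ?case by (meson upgrade_ann_ctx_mono wf_ctx_has_type_eq_type.ty_app)
next
  case (ty_conv \<Gamma> t T T' s)
  then show ?case by (meson wf_ctx_has_type_eq_type.ty_conv)
next
  case (eq_beta r U \<Gamma> t T u)
  then show ?case by (meson upgrade_lift upgrade_ann_ctx_mono wf_ctx_has_type_eq_type.eq_beta)
next
  case (eq_eta \<Gamma> t r U s s' T)
  show ?case by (rule wf_ctx_has_type_eq_type.eq_eta[OF eq_eta.IH[OF eq_eta.prems]])
next
  case (eq_refl \<Gamma> t T)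
  then show ?case by (meson wf_ctx_has_type_eq_type.eq_refl)
next
  case (eq_sym \<Gamma> t t' T)
  then show ?case by (meson wf_ctx_has_type_eq_type.eq_sym)
next
  case (eq_trans \<Gamma> t1 t2 T t3)
  then show ?case by (meson wf_ctx_has_type_eq_type.eq_trans)
next
  case (eq_pi \<Gamma> U U' s1 r T T' s2 s3)
  then show ?case by (meson upgrade_lift wf_ctx_has_type_eq_type.eq_pi)
next
  case (eq_lam \<Gamma> U U' s1 r T s2 t t')
  then show ?case by (meson upgrade_lift wf_ctx_has_type_eq_type.eq_lam)
next
  case (eq_app_rel \<Gamma> t t' U s s' T u u')
  then show ?case by (meson wf_ctx_has_type_eq_type.eq_app_rel)
next
  case (eq_app_irr \<Gamma> t t' U s s' T u u')
  then show ?case by (meson upgrade_resurrect_mono wf_ctx_has_type_eq_type.eq_app_irr)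
next
  case (eq_conv \<Gamma> t t' T T' s)
  then show ?case by (meson wf_ctx_has_type_eq_type.eq_conv)
qed

lemma typing_wf:
  "\<turnstile> \<Gamma> \<Longrightarrow> True"
  "\<Gamma> \<turnstile> t : T \<Longrightarrow> \<turnstile> \<Gamma>"
  "\<Gamma> \<turnstile> t = t' : T \<Longrightarrow> \<turnstile> \<Gamma>"
  by (induction rule: wf_ctx_has_type_eq_type.inducts) (auto elim: wf_ctx.cases)

lemma wf_ConsD: "\<turnstile> (r, U) # \<Gamma> \<Longrightarrow> \<turnstile> \<Gamma> \<and> (\<exists>s. \<Gamma> \<turnstile> U : Sort s)"
  by (auto elim: wf_ctx.cases)

lemma Rule_ex: "\<exists>s3. (s1, s2, s3) \<in> Rule"
  by (cases s1; cases s2) (auto simp: Rule_def)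

lemma Axiom_ex: "\<exists>s'. (s, s') \<in> Axiom"
  by (cases s) (auto simp: Axiom_def)

text \<open>Only \<open>ty_pi\<close> and \<open>ty_conv\<close> conclude a typing of a function
  type, and conversion keeps the subject. As the sorts are part of the syntax, domain and codomain
  are recovered at exactly these sorts.\<close>

lemma pi_inversion: "\<Gamma> \<turnstile> A : B \<Longrightarrow> A = Pi r U s s' T \<Longrightarrow> \<Gamma> \<turnstile> U : Sort s \<and> (r, U) # \<Gamma> \<turnstile> T : Sort s'"
  by (induction \<Gamma> A B rule: wf_ctx_has_type_eq_type.inducts(2)
      [where ?P1.0 = "\<lambda>_. True" and ?P3.0 = "\<lambda>_ _ _ _. True"]) auto

lemmas pi_inv = pi_inversion[OF _ refl, THEN conjunct1] pi_inversion[OF _ refl, THEN conjunct2]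

lemma upgrade_wf_ann: "\<turnstile> \<Gamma> \<Longrightarrow> \<turnstile> ann_ctx r \<Gamma>"
  using upgrade_typing(1) upgrade_ann_ctx by blast

lemma ann_ctx_typing: "\<Gamma> \<turnstile> t : T \<Longrightarrow> ann_ctx r \<Gamma> \<turnstile> t : T"
  using upgrade_typing(2) upgrade_ann_ctx by blast

lemma ann_ctx_eq: "\<Gamma> \<turnstile> t = t' : T \<Longrightarrow> ann_ctx r \<Gamma> \<turnstile> t = t' : T"
  using upgrade_typing(3) upgrade_ann_ctx by blast

lemma ann_ctx_nth: "i < length \<Gamma> \<Longrightarrow> ann_ctx r \<Gamma> ! i = (if r = Rel then fst (\<Gamma> ! i) else Rel, snd (\<Gamma> ! i))"
  by (cases r) (auto simp: resurrect_def split: prod.splits)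

lemma length_ann_ctx [simp]: "length (ann_ctx r \<Gamma>) = length \<Gamma>"
  by (cases r) (auto simp: resurrect_def)

text \<open>
  The rule \<open>eq_beta\<close> has no premise that types the domain \<open>U\<close> in \<open>\<Gamma>\<close>, so inductions that pass under
  a binder also carry the induction statement for the types of the context.
\<close>

primrec ctx_all :: "(ctx \<Rightarrow> expr \<Rightarrow> expr \<Rightarrow> bool) \<Rightarrow> ctx \<Rightarrow> bool" where
  "ctx_all Q [] = True"
| "ctx_all Q (b # \<Gamma>) = ((\<exists>s. Q \<Gamma> (snd b) (Sort s)) \<and> ctx_all Q \<Gamma>)"

section \<open>Substitution\<close>

text \<open>
  Substitution under a binder needs weakening, that is, renaming. Both are instances of the same
  induction, for a class \<open>ok\<close> of substitutions that is closed under lifting and resurrection.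
\<close>

locale subst_class =
  fixes ok :: "ctx \<Rightarrow> (nat \<Rightarrow> expr) \<Rightarrow> ctx \<Rightarrow> bool"
  assumes ok_ann: "ok \<Delta> \<sigma> \<Gamma> \<Longrightarrow> ok (ann_ctx r \<Delta>) \<sigma> (ann_ctx r \<Gamma>)"
    and ok_up: "\<turnstile> (r, subst \<sigma> U) # \<Delta> \<Longrightarrow> ok \<Delta> \<sigma> \<Gamma> \<Longrightarrow>
      ok ((r, subst \<sigma> U) # \<Delta>) (up_subst \<sigma>) ((r, U) # \<Gamma>)"
    and ok_var: "\<turnstile> \<Delta> \<Longrightarrow> ok \<Delta> \<sigma> \<Gamma> \<Longrightarrow> i < length \<Gamma> \<Longrightarrow> \<Gamma> ! i = (Rel, U) \<Longrightarrow>
      \<Delta> \<turnstile> \<sigma> i : subst \<sigma> (wk (Suc i) U)"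
begin

definition typing_prop :: "ctx \<Rightarrow> expr \<Rightarrow> expr \<Rightarrow> bool" where
  "typing_prop \<Gamma> t T \<longleftrightarrow>
     (\<forall>\<Delta> \<sigma>. \<turnstile> \<Delta> \<longrightarrow> ok \<Delta> \<sigma> \<Gamma> \<longrightarrow> \<Delta> \<turnstile> subst \<sigma> t : subst \<sigma> T)"

definition eq_prop :: "ctx \<Rightarrow> expr \<Rightarrow> expr \<Rightarrow> expr \<Rightarrow> bool" where
  "eq_prop \<Gamma> t t' T \<longleftrightarrow>
     (\<forall>\<Delta> \<sigma>. \<turnstile> \<Delta> \<longrightarrow> ok \<Delta> \<sigma> \<Gamma> \<longrightarrow> \<Delta> \<turnstile> subst \<sigma> t = subst \<sigma> t' : subst \<sigma> T)"

lemma typing_propD: "typing_prop \<Gamma> t T \<Longrightarrow> \<turnstile> \<Delta> \<Longrightarrow> ok \<Delta> \<sigma> \<Gamma> \<Longrightarrow>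
    \<Delta> \<turnstile> subst \<sigma> t : subst \<sigma> T"
  by (simp add: typing_prop_def)

lemma eq_propD: "eq_prop \<Gamma> t t' T \<Longrightarrow> \<turnstile> \<Delta> \<Longrightarrow> ok \<Delta> \<sigma> \<Gamma> \<Longrightarrow>
    \<Delta> \<turnstile> subst \<sigma> t = subst \<sigma> t' : subst \<sigma> T"
  by (simp add: eq_prop_def)

lemma typing_aux:
  "\<turnstile> \<Gamma> \<Longrightarrow> ctx_all typing_prop \<Gamma>"
  "\<Gamma> \<turnstile> t : T \<Longrightarrow> ctx_all typing_prop \<Gamma> \<and> typing_prop \<Gamma> t T"
  "\<Gamma> \<turnstile> t = t' : T \<Longrightarrow> ctx_all typing_prop \<Gamma> \<and> eq_prop \<Gamma> t t' T"
proof (induction rule: wf_ctx_has_type_eq_type.inducts)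
  case wf_empty
  then show ?case by simp
next
  case (wf_ext \<Gamma> T s r)
  then show ?case by auto
next
  case (ty_sort \<Gamma> s s')
  then show ?case by (auto simp: typing_prop_def intro: wf_ctx_has_type_eq_type.ty_sort)
next
  case (ty_pi \<Gamma> U s1 r T s2 s3)
  have "\<Delta> \<turnstile> subst \<sigma> (Pi r U s1 s2 T) : subst \<sigma> (Sort s3)" if \<Delta>: "\<turnstile> \<Delta>" "ok \<Delta> \<sigma> \<Gamma>" for \<Delta> \<sigma>
  proof -
    have U: "\<Delta> \<turnstile> subst \<sigma> U : Sort s1"
      using ty_pi.IH(1) typing_propD \<Delta> by fastforce
    have "(r, subst \<sigma> U) # \<Delta> \<turnstile> subst (up_subst \<sigma>) T : Sort s2"
      using ty_pi.IH(2) typing_propD[OF _ wf_ext[OF \<Delta>(1) U] ok_up[OF wf_ext[OF \<Delta>(1) U] \<Delta>(2)]]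
      by fastforce
    then show ?thesis using U ty_pi.hyps by (auto intro: wf_ctx_has_type_eq_type.ty_pi)
  qed
  then show ?case using ty_pi.IH by (auto simp: typing_prop_def)
next
  case (ty_var \<Gamma> i U)
  then show ?case using ok_var unfolding typing_prop_def by (auto simp del: rename.simps)
next
  case (ty_lam r U \<Gamma> t T s s' s'')
  have "\<Delta> \<turnstile> subst \<sigma> (Lam r U t) : subst \<sigma> (Pi r U s s' T)" if \<Delta>: "\<turnstile> \<Delta>" "ok \<Delta> \<sigma> \<Gamma>" for \<Delta> \<sigma>
  proof -
    have P: "\<Delta> \<turnstile> Pi r (subst \<sigma> U) s s' (subst (up_subst \<sigma>) T) : Sort s''"
      using ty_lam.IH(2) typing_propD \<Delta> by fastforce
    note U = pi_inv(1)[OF P]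
    have "(r, subst \<sigma> U) # \<Delta> \<turnstile> subst (up_subst \<sigma>) t : subst (up_subst \<sigma>) T"
      using ty_lam.IH(1) typing_propD[OF _ wf_ext[OF \<Delta>(1) U] ok_up[OF wf_ext[OF \<Delta>(1) U] \<Delta>(2)]]
      by blast
    then show ?thesis using P by (auto intro: wf_ctx_has_type_eq_type.ty_lam)
  qed
  then show ?case using ty_lam.IH unfolding typing_prop_def by blast
next
  case (ty_app \<Gamma> t r U s s' T u)
  have "\<Delta> \<turnstile> subst \<sigma> (App r t u) : subst \<sigma> (T\<langle>u\<rangle>)" if \<Delta>: "\<turnstile> \<Delta>" "ok \<Delta> \<sigma> \<Gamma>" for \<Delta> \<sigma>
  proof -
    have t: "\<Delta> \<turnstile> subst \<sigma> t : Pi r (subst \<sigma> U) s s' (subst (up_subst \<sigma>) T)"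
      using ty_app.IH(1) typing_propD \<Delta> by fastforce
    have u: "ann_ctx r \<Delta> \<turnstile> subst \<sigma> u : subst \<sigma> U"
      using ty_app.IH(2) typing_propD[OF _ upgrade_wf_ann[OF \<Delta>(1)] ok_ann[OF \<Delta>(2)]]
      by fastforce
    show ?thesis
      using wf_ctx_has_type_eq_type.ty_app[OF t u] by (simp only: subst.simps subst_subst1_up)
  qed
  then show ?case using ty_app.IH unfolding typing_prop_def by blast
next
  case (ty_conv \<Gamma> t T T' s)
  then show ?case unfolding typing_prop_def eq_prop_def
    by simp (meson wf_ctx_has_type_eq_type.ty_conv)
next
  case (eq_beta r U \<Gamma> t T u)
  have "\<Delta> \<turnstile> subst \<sigma> (App r (Lam r U t) u) = subst \<sigma> (t\<langle>u\<rangle>) : subst \<sigma> (T\<langle>u\<rangle>)"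
    if \<Delta>: "\<turnstile> \<Delta>" "ok \<Delta> \<sigma> \<Gamma>" for \<Delta> \<sigma>
  proof -
    obtain s where U: "\<Delta> \<turnstile> subst \<sigma> U : Sort s"
      using eq_beta.IH(1) typing_propD \<Delta> by fastforce
    have t: "(r, subst \<sigma> U) # \<Delta> \<turnstile> subst (up_subst \<sigma>) t : subst (up_subst \<sigma>) T"
      using eq_beta.IH(1) typing_propD[OF _ wf_ext[OF \<Delta>(1) U] ok_up[OF wf_ext[OF \<Delta>(1) U] \<Delta>(2)]]
      by blast
    have u: "ann_ctx r \<Delta> \<turnstile> subst \<sigma> u : subst \<sigma> U"
      using eq_beta.IH(2) typing_propD[OF _ upgrade_wf_ann[OF \<Delta>(1)] ok_ann[OF \<Delta>(2)]]
      by fastforce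
    show ?thesis
      using wf_ctx_has_type_eq_type.eq_beta[OF t u] by (simp only: subst.simps subst_subst1_up)
  qed
  then show ?case using eq_beta.IH unfolding eq_prop_def by auto
next
  case (eq_eta \<Gamma> t r U s s' T)
  have "\<Delta> \<turnstile> subst \<sigma> t = subst \<sigma> (Lam r U (App r (wk 1 t) (Var 0))) : subst \<sigma> (Pi r U s s' T)"
    if \<Delta>: "\<turnstile> \<Delta>" "ok \<Delta> \<sigma> \<Gamma>" for \<Delta> \<sigma>
  proof -
    have t: "\<Delta> \<turnstile> subst \<sigma> t : Pi r (subst \<sigma> U) s s' (subst (up_subst \<sigma>) T)"
      using eq_eta.IH typing_propD \<Delta> by fastforce
    show ?thesis
      using wf_ctx_has_type_eq_type.eq_eta[OF t] by (simp only: subst.simps subst_up_wk up_subst.simps)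
  qed
  then show ?case using eq_eta.IH unfolding eq_prop_def by blast
next
  case (eq_refl \<Gamma> t T)
  then show ?case unfolding typing_prop_def eq_prop_def
    by (auto intro: wf_ctx_has_type_eq_type.eq_refl)
next
  case (eq_sym \<Gamma> t t' T)
  then show ?case unfolding eq_prop_def
    by (auto intro: wf_ctx_has_type_eq_type.eq_sym)
next
  case (eq_trans \<Gamma> t1 t2 T t3)
  then show ?case unfolding eq_prop_def
    by (meson wf_ctx_has_type_eq_type.eq_trans)
next
  case (eq_pi \<Gamma> U U' s1 r T T' s2 s3)
  have "\<Delta> \<turnstile> subst \<sigma> (Pi r U s1 s2 T) = subst \<sigma> (Pi r U' s1 s2 T') : subst \<sigma> (Sort s3)"
    if \<Delta>: "\<turnstile> \<Delta>" "ok \<Delta> \<sigma> \<Gamma>" for \<Delta> \<sigma>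
  proof -
    have U: "\<Delta> \<turnstile> subst \<sigma> U = subst \<sigma> U' : Sort s1"
      using eq_pi.IH(1) eq_propD \<Delta> by fastforce
    obtain s where "\<Delta> \<turnstile> subst \<sigma> U : Sort s"
      using eq_pi.IH(2) typing_propD \<Delta> by fastforce
    note \<Delta>' = wf_ext[OF \<Delta>(1) this]
    have "(r, subst \<sigma> U) # \<Delta> \<turnstile> subst (up_subst \<sigma>) T = subst (up_subst \<sigma>) T' : Sort s2"
      using eq_pi.IH(2) eq_propD[OF _ \<Delta>' ok_up[OF \<Delta>' \<Delta>(2)]]
      by fastforce
    then show ?thesis using U eq_pi.hyps by (auto intro: wf_ctx_has_type_eq_type.eq_pi)
  qed
  then show ?case using eq_pi.IH by (auto simp: eq_prop_def)
next
  case (eq_lam \<Gamma> U U' s1 r T s2 t t')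
  have "\<Delta> \<turnstile> subst \<sigma> (Lam r U t) = subst \<sigma> (Lam r U' t') : subst \<sigma> (Pi r U s1 s2 T)"
    if \<Delta>: "\<turnstile> \<Delta>" "ok \<Delta> \<sigma> \<Gamma>" for \<Delta> \<sigma>
  proof -
    have U: "\<Delta> \<turnstile> subst \<sigma> U = subst \<sigma> U' : Sort s1"
      using eq_lam.IH(1) eq_propD \<Delta> by fastforce
    obtain s where "\<Delta> \<turnstile> subst \<sigma> U : Sort s"
      using eq_lam.IH(2) typing_propD \<Delta> by fastforce
    note \<Delta>' = wf_ext[OF \<Delta>(1) this] ok_up[OF wf_ext[OF \<Delta>(1) this] \<Delta>(2)]
    have T: "(r, subst \<sigma> U) # \<Delta> \<turnstile> subst (up_subst \<sigma>) T : Sort s2"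
      using eq_lam.IH(2) typing_propD[OF _ \<Delta>'] by fastforce
    have t: "(r, subst \<sigma> U) # \<Delta> \<turnstile> subst (up_subst \<sigma>) t = subst (up_subst \<sigma>) t' : subst (up_subst \<sigma>) T"
      using eq_lam.IH(3) eq_propD[OF _ \<Delta>'] by fastforce
    show ?thesis using wf_ctx_has_type_eq_type.eq_lam[OF U T t] by simp
  qed
  then show ?case using eq_lam.IH by (auto simp: eq_prop_def)
next
  case (eq_app_rel \<Gamma> t t' U s s' T u u')
  have "\<Delta> \<turnstile> subst \<sigma> (App Rel t u) = subst \<sigma> (App Rel t' u') : subst \<sigma> (T\<langle>u\<rangle>)"
    if \<Delta>: "\<turnstile> \<Delta>" "ok \<Delta> \<sigma> \<Gamma>" for \<Delta> \<sigma>
  proof -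
    have t: "\<Delta> \<turnstile> subst \<sigma> t = subst \<sigma> t' : Pi Rel (subst \<sigma> U) s s' (subst (up_subst \<sigma>) T)"
      using eq_app_rel.IH(1) eq_propD \<Delta> by fastforce
    have u: "\<Delta> \<turnstile> subst \<sigma> u = subst \<sigma> u' : subst \<sigma> U"
      using eq_app_rel.IH(2) eq_propD \<Delta> by fastforce
    show ?thesis
      using wf_ctx_has_type_eq_type.eq_app_rel[OF t u] by (simp only: subst.simps subst_subst1_up)
  qed
  then show ?case using eq_app_rel.IH unfolding eq_prop_def by blast
next
  case (eq_app_irr \<Gamma> t t' U s s' T u u')
  have "\<Delta> \<turnstile> subst \<sigma> (App Irr t u) = subst \<sigma> (App Irr t' u') : subst \<sigma> (T\<langle>u\<rangle>)"
    if \<Delta>: "\<turnstile> \<Delta>" "ok \<Delta> \<sigma> \<Gamma>" for \<Delta> \<sigma>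
  proof -
    note \<Delta>' = upgrade_wf_ann[OF \<Delta>(1), of Irr, simplified] ok_ann[OF \<Delta>(2), of Irr, simplified]
    have t: "\<Delta> \<turnstile> subst \<sigma> t = subst \<sigma> t' : Pi Irr (subst \<sigma> U) s s' (subst (up_subst \<sigma>) T)"
      using eq_app_irr.IH(1) eq_propD \<Delta> by fastforce
    have u: "\<Delta>\<^sup>\<oplus> \<turnstile> subst \<sigma> u : subst \<sigma> U" "\<Delta>\<^sup>\<oplus> \<turnstile> subst \<sigma> u' : subst \<sigma> U"
      using eq_app_irr.IH(2,3) typing_propD \<Delta>' by blast+
    show ?thesis
      using wf_ctx_has_type_eq_type.eq_app_irr[OF t u] by (simp only: subst.simps subst_subst1_up)
  qed
  then show ?case using eq_app_irr.IH unfolding eq_prop_def by blast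
next
  case (eq_conv \<Gamma> t t' T T' s)
  then show ?case unfolding eq_prop_def
    by simp (meson wf_ctx_has_type_eq_type.eq_conv)
qed

lemma typing: "\<Gamma> \<turnstile> t : T \<Longrightarrow> \<turnstile> \<Delta> \<Longrightarrow> ok \<Delta> \<sigma> \<Gamma> \<Longrightarrow> \<Delta> \<turnstile> subst \<sigma> t : subst \<sigma> T"
  using typing_aux(2) typing_propD by blast

lemma equality: "\<Gamma> \<turnstile> t = t' : T \<Longrightarrow> \<turnstile> \<Delta> \<Longrightarrow> ok \<Delta> \<sigma> \<Gamma> \<Longrightarrow>
    \<Delta> \<turnstile> subst \<sigma> t = subst \<sigma> t' : subst \<sigma> T"
  using typing_aux(3) eq_propD by blast

end

section \<open>Renamings and typed substitutions\<close>

definition ren_ok :: "ctx \<Rightarrow> (nat \<Rightarrow> nat) \<Rightarrow> ctx \<Rightarrow> bool" where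
  "ren_ok \<Delta> \<rho> \<Gamma> \<longleftrightarrow> (\<forall>i < length \<Gamma>. \<rho> i < length \<Delta> \<and> fst (\<Delta> ! \<rho> i) = fst (\<Gamma> ! i) \<and>
     wk (Suc (\<rho> i)) (snd (\<Delta> ! \<rho> i)) = rename \<rho> (wk (Suc i) (snd (\<Gamma> ! i))))"

lemma ren_ok_ann: "ren_ok \<Delta> \<rho> \<Gamma> \<Longrightarrow> ren_ok (ann_ctx r \<Delta>) \<rho> (ann_ctx r \<Gamma>)"
  by (simp add: ren_ok_def ann_ctx_nth)

lemma ren_ok_up: "ren_ok \<Delta> \<rho> \<Gamma> \<Longrightarrow> ren_ok ((r, rename \<rho> U) # \<Delta>) (up_ren \<rho>) ((r, U) # \<Gamma>)"
  unfolding ren_ok_def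
proof (intro allI impI)
  fix i
  assume *: "\<forall>i<length \<Gamma>. \<rho> i < length \<Delta> \<and> fst (\<Delta> ! \<rho> i) = fst (\<Gamma> ! i) \<and>
     wk (Suc (\<rho> i)) (snd (\<Delta> ! \<rho> i)) = rename \<rho> (wk (Suc i) (snd (\<Gamma> ! i)))"
    and i: "i < length ((r, U) # \<Gamma>)"
  show "up_ren \<rho> i < length ((r, rename \<rho> U) # \<Delta>) \<and>
    fst (((r, rename \<rho> U) # \<Delta>) ! up_ren \<rho> i) = fst (((r, U) # \<Gamma>) ! i) \<and>
    wk (Suc (up_ren \<rho> i)) (snd (((r, rename \<rho> U) # \<Delta>) ! up_ren \<rho> i)) =
      rename (up_ren \<rho>) (wk (Suc i) (snd (((r, U) # \<Gamma>) ! i)))"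
  proof (cases i)
    case 0
    then show ?thesis by (simp add: rename_rename comp_def)
  next
    case (Suc j)
    have "wk 1 (wk (Suc (\<rho> j)) (snd (\<Delta> ! \<rho> j))) = wk 1 (rename \<rho> (wk (Suc j) (snd (\<Gamma> ! j))))"
      using * i Suc by auto
    then show ?thesis using * i Suc by (auto simp: rename_rename comp_def)
  qed
qed

lemma ren_ok_wk: "ren_ok (b # \<Gamma>) Suc \<Gamma>"
  by (simp add: ren_ok_def rename_rename comp_def)

text \<open>A renaming is a substitution by variables, so the induction of the locale also yields
  weakening. Lifting it gives again a renaming, by \<open>up_subst_ren\<close>; hence weakening is
  not presupposed here.\<close>

interpretation renaming: subst_class "\<lambda>\<Delta> \<sigma> \<Gamma>. \<exists>\<rho>. \<sigma> = Var \<circ> \<rho> \<and> ren_ok \<Delta> \<rho> \<Gamma>"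
proof
  fix \<Delta> \<sigma> \<Gamma> r
  assume "\<exists>\<rho>. \<sigma> = Var \<circ> \<rho> \<and> ren_ok \<Delta> \<rho> \<Gamma>"
  then show "\<exists>\<rho>. \<sigma> = Var \<circ> \<rho> \<and> ren_ok (ann_ctx r \<Delta>) \<rho> (ann_ctx r \<Gamma>)"
    using ren_ok_ann by blast
next
  fix \<Delta> \<sigma> \<Gamma> r U
  assume "\<exists>\<rho>. \<sigma> = Var \<circ> \<rho> \<and> ren_ok \<Delta> \<rho> \<Gamma>"
  then obtain \<rho> where \<rho>: "\<sigma> = Var \<circ> \<rho>" "ren_ok \<Delta> \<rho> \<Gamma>" by blast
  have "ren_ok ((r, subst \<sigma> U) # \<Delta>) (up_ren \<rho>) ((r, U) # \<Gamma>)"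
    using ren_ok_up[OF \<rho>(2)] by (simp add: \<rho>(1) rename_eq_subst)
  then show "\<exists>\<rho>. up_subst \<sigma> = Var \<circ> \<rho> \<and> ren_ok ((r, subst \<sigma> U) # \<Delta>) \<rho> ((r, U) # \<Gamma>)"
    using \<rho>(1) up_subst_ren by blast
next
  fix \<Delta> \<sigma> \<Gamma> i U
  assume wf: "\<turnstile> \<Delta>" and "\<exists>\<rho>. \<sigma> = Var \<circ> \<rho> \<and> ren_ok \<Delta> \<rho> \<Gamma>"
    and i: "i < length \<Gamma>" "\<Gamma> ! i = (Rel, U)"
  then obtain \<rho> where \<rho>: "\<sigma> = Var \<circ> \<rho>" "ren_ok \<Delta> \<rho> \<Gamma>" by blast
  have *: "\<rho> i < length \<Delta>" "\<Delta> ! \<rho> i = (Rel, snd (\<Delta> ! \<rho> i))"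
    "wk (Suc (\<rho> i)) (snd (\<Delta> ! \<rho> i)) = subst \<sigma> (wk (Suc i) U)"
    using i \<rho> unfolding ren_ok_def rename_eq_subst[of \<rho>] by (auto simp: prod_eq_iff)
  show "\<Delta> \<turnstile> \<sigma> i : subst \<sigma> (wk (Suc i) U)"
    using ty_var[OF wf *(1,2)] unfolding *(3) by (simp add: \<rho>(1))
qed

lemma wk_typing: "\<Gamma> \<turnstile> t : T \<Longrightarrow> \<turnstile> b # \<Gamma> \<Longrightarrow> b # \<Gamma> \<turnstile> wk 1 t : wk 1 T"
  using renaming.typing[of \<Gamma> t T "b # \<Gamma>" "Var \<circ> Suc"] ren_ok_wk[of b]
  by (auto simp: rename_eq_subst comp_def)

lemma wk_eq: "\<Gamma> \<turnstile> t = t' : T \<Longrightarrow> \<turnstile> b # \<Gamma> \<Longrightarrow> b # \<Gamma> \<turnstile> wk 1 t = wk 1 t' : wk 1 T"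
  using renaming.equality[of \<Gamma> t t' T "b # \<Gamma>" "Var \<circ> Suc"] ren_ok_wk[of b]
  by (auto simp: rename_eq_subst comp_def)

text \<open>In a well-typed term an irrelevant variable occurs only where the context has been
  resurrected, so its value is asked to be typed in \<open>\<Delta>\<^sup>\<oplus>\<close>
  only.\<close>

definition sub_ok :: "ctx \<Rightarrow> (nat \<Rightarrow> expr) \<Rightarrow> ctx \<Rightarrow> bool" where
  "sub_ok \<Delta> \<sigma> \<Gamma> \<longleftrightarrow> (\<forall>i < length \<Gamma>.
     ann_ctx (fst (\<Gamma> ! i)) \<Delta> \<turnstile> \<sigma> i : subst \<sigma> (wk (Suc i) (snd (\<Gamma> ! i))))"

lemma ann_ctx_Cons: "ann_ctx r ((r', U) # \<Gamma>) = (if r = Rel then r' else Rel, U) # ann_ctx r \<Gamma>"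
  by (cases r) (auto simp: resurrect_def)

lemma ann_ctx_ann_ctx: "ann_ctx r (ann_ctx r' \<Gamma>) = ann_ctx (if r = Rel then r' else Irr) \<Gamma>"
  by (cases r; cases r') (auto simp: resurrect_def)

text \<open>No variable rule applies to an irrelevant binding in its own context; resurrection makes
  the variable usable, for instance as the irrelevant argument in an \<eta>-expansion.\<close>

lemma bound_var_typing: "\<turnstile> (r, U) # \<Gamma> \<Longrightarrow> ann_ctx r ((r, U) # \<Gamma>) \<turnstile> Var 0 : wk 1 U"
  using ty_var[of "ann_ctx r ((r, U) # \<Gamma>)" 0 U] upgrade_wf_ann[of "(r, U) # \<Gamma>" r]
  by (auto simp: ann_ctx_Cons split: if_splits)

lemma sub_ok_up:
  assumes wf: "\<turnstile> (r, subst \<sigma> U) # \<Delta>" and \<sigma>: "sub_ok \<Delta> \<sigma> \<Gamma>"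
  shows "sub_ok ((r, subst \<sigma> U) # \<Delta>) (up_subst \<sigma>) ((r, U) # \<Gamma>)"
  unfolding sub_ok_def
proof (intro allI impI)
  fix i
  assume i: "i < length ((r, U) # \<Gamma>)"
  show "ann_ctx (fst (((r, U) # \<Gamma>) ! i)) ((r, subst \<sigma> U) # \<Delta>) \<turnstile> up_subst \<sigma> i :
    subst (up_subst \<sigma>) (wk (Suc i) (snd (((r, U) # \<Gamma>) ! i)))"
  proof (cases i)
    case 0
    have "subst (up_subst \<sigma>) (wk (Suc 0) U) = wk 1 (subst \<sigma> U)"
      using subst_up_wk by simp
    then show ?thesis using bound_var_typing[OF wf] 0 by (simp del: ann_ctx.simps)
  next
    case (Suc j)
    define r' W where "r' = fst (\<Gamma> ! j)" and "W = snd (\<Gamma> ! j)"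
    have "ann_ctx r' \<Delta> \<turnstile> \<sigma> j : subst \<sigma> (wk (Suc j) W)"
      using \<sigma> i Suc unfolding sub_ok_def r'_def W_def by auto
    then have "ann_ctx r' ((r, subst \<sigma> U) # \<Delta>) \<turnstile> wk 1 (\<sigma> j) : wk 1 (subst \<sigma> (wk (Suc j) W))"
      using wk_typing upgrade_wf_ann[OF wf, of r'] by (simp add: ann_ctx_Cons)
    moreover have "wk 1 (subst \<sigma> (wk (Suc j) W)) = subst (up_subst \<sigma>) (wk (Suc i) W)"
      unfolding Suc wk_1_wk[symmetric] subst_up_wk ..
    ultimately show ?thesis using Suc unfolding r'_def W_def by simp
  qed
qed

text \<open>For closure under resurrection, values of relevant variables are retyped by upgrading,
  those of irrelevant variables are already typed in the resurrected context, and resurrecting twice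
  changes nothing more.\<close>

interpretation substitution: subst_class sub_ok
proof
  show "sub_ok (ann_ctx r \<Delta>) \<sigma> (ann_ctx r \<Gamma>)" if \<sigma>: "sub_ok \<Delta> \<sigma> \<Gamma>" for \<Delta> \<sigma> \<Gamma> r
  proof (cases r)
    case Irr
    have "ann_ctx Rel (ann_ctx Irr \<Delta>) \<turnstile> \<sigma> i : subst \<sigma> (wk (Suc i) (snd (\<Gamma> ! i)))"
      if "i < length \<Gamma>" for i
      using \<sigma>[unfolded sub_ok_def, rule_format, OF that] ann_ctx_typing[of _ _ _ Irr]
      by (auto simp: ann_ctx_ann_ctx simp del: ann_ctx.simps(2) dest: ann_ctx_typing[of _ _ _ Irr])
    then show ?thesis
      using Irr by (simp add: sub_ok_def ann_ctx_nth del: ann_ctx.simps rename.simps)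
  qed (use \<sigma> in simp)
  show "sub_ok ((r, subst \<sigma> U) # \<Delta>) (up_subst \<sigma>) ((r, U) # \<Gamma>)"
    if "\<turnstile> (r, subst \<sigma> U) # \<Delta>" "sub_ok \<Delta> \<sigma> \<Gamma>" for \<Delta> \<sigma> \<Gamma> r U
    using that by (rule sub_ok_up)
  show "\<Delta> \<turnstile> \<sigma> i : subst \<sigma> (wk (Suc i) U)"
    if "sub_ok \<Delta> \<sigma> \<Gamma>" "i < length \<Gamma>" "\<Gamma> ! i = (Rel, U)" for \<Delta> \<sigma> \<Gamma> i U
    using that unfolding sub_ok_def by (metis ann_ctx.simps(1) fst_conv snd_conv)
qed

lemma sub_ok_Cons: "sub_ok \<Delta> \<sigma> ((r, U) # \<Gamma>) \<longleftrightarrow>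
    sub_ok \<Delta> (\<sigma> \<circ> Suc) \<Gamma> \<and> ann_ctx r \<Delta> \<turnstile> \<sigma> 0 : subst (\<sigma> \<circ> Suc) U"
  unfolding sub_ok_def length_Cons All_less_Suc2 by (auto simp: subst_rename comp_def)

lemma sub_ok_Nil: "sub_ok \<Delta> \<sigma> []"
  by (simp add: sub_ok_def)

lemma sub_ok_Var: "\<turnstile> \<Gamma> \<Longrightarrow> sub_ok \<Gamma> Var \<Gamma>"
  unfolding sub_ok_def subst_Var
proof (intro allI impI)
  fix i
  assume "\<turnstile> \<Gamma>" "i < length \<Gamma>"
  then show "ann_ctx (fst (\<Gamma> ! i)) \<Gamma> \<turnstile> Var i : wk (Suc i) (snd (\<Gamma> ! i))"
    by (intro ty_var upgrade_wf_ann) (auto simp: ann_ctx_nth prod_eq_iff intro: ann.exhaust)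
qed

lemma sub_ok_subst1: "\<turnstile> \<Gamma> \<Longrightarrow> ann_ctx r \<Gamma> \<turnstile> u : U \<Longrightarrow> sub_ok \<Gamma> (case_nat u Var) ((r, U) # \<Gamma>)"
  using sub_ok_Var by (simp add: sub_ok_Cons comp_def subst_Var)

lemma subst1_typing: "(r, U) # \<Gamma> \<turnstile> t : T \<Longrightarrow> ann_ctx r \<Gamma> \<turnstile> u : U \<Longrightarrow> \<Gamma> \<turnstile> t\<langle>u\<rangle> : T\<langle>u\<rangle>"
  unfolding subst1_eq
  by (meson substitution.typing sub_ok_subst1 typing_wf(2) wf_ConsD)

text \<open>Changing the type of a binding to an equal one is a substitution that leaves every
  variable in place; only the bound variable has to be retyped, by conversion along the weakened
  equality.\<close>

lemma ctx_conversion_sub: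
  assumes U': "\<Gamma> \<turnstile> U' : Sort s" and eq: "\<Gamma> \<turnstile> U = U' : Sort s'"
  shows "sub_ok ((r, U') # \<Gamma>) Var ((r, U) # \<Gamma>)"
proof -
  have wf: "\<turnstile> (r, U') # \<Gamma>"
    using wf_ext typing_wf(2) U' by blast
  have "(r, U') # \<Gamma> \<turnstile> wk 1 U' = wk 1 U : Sort s'"
    using wk_eq[OF eq_sym[OF eq] wf] by simp
  then have "ann_ctx r ((r, U') # \<Gamma>) \<turnstile> Var 0 : wk 1 U"
    using ty_conv[OF bound_var_typing[OF wf]] ann_ctx_eq by blast
  moreover have "sub_ok ((r, U') # \<Gamma>) Var ((r, U') # \<Gamma>)"
    using sub_ok_Var[OF wf] .
  ultimately show ?thesis
    by (simp add: sub_ok_Cons rename_eq_subst comp_def del: ann_ctx.simps)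
qed

lemma ctx_conversion:
  assumes "\<Gamma> \<turnstile> U' : Sort s" "\<Gamma> \<turnstile> U = U' : Sort s'" "(r, U) # \<Gamma> \<turnstile> t : T"
  shows "(r, U') # \<Gamma> \<turnstile> t : T"
  using substitution.typing[OF assms(3) _ ctx_conversion_sub[OF assms(1,2)]]
    wf_ext[OF typing_wf(2)] assms(1) by (simp add: subst_Var)

section \<open>Syntactic validity\<close>

lemma eq_app:
  assumes "\<Gamma> \<turnstile> t = t' : Pi r U s s' T"
    and "r = Rel \<Longrightarrow> \<Gamma> \<turnstile> u = u' : U"
    and "r = Irr \<Longrightarrow> \<Gamma>\<^sup>\<oplus> \<turnstile> u : U \<and> \<Gamma>\<^sup>\<oplus> \<turnstile> u' : U"
  shows "\<Gamma> \<turnstile> App r t u = App r t' u' : T\<langle>u\<rangle>"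
  using assms by (cases r) (auto intro: eq_app_rel eq_app_irr)

text \<open>\<open>\<beta>\<close>-expansion of \<open>T\<close> reduces this to the congruence rule for application.\<close>

lemma eq_subst1_type:
  assumes T: "(r, U) # \<Gamma> \<turnstile> T : Sort s'"
    and u: "ann_ctx r \<Gamma> \<turnstile> u : U" "ann_ctx r \<Gamma> \<turnstile> u' : U" "r = Rel \<Longrightarrow> \<Gamma> \<turnstile> u = u' : U"
  shows "\<Gamma> \<turnstile> T\<langle>u\<rangle> = T\<langle>u'\<rangle> : Sort s'"
proof -
  obtain s where U: "\<Gamma> \<turnstile> U : Sort s"
    using wf_ConsD typing_wf(2) T by blast
  obtain s'' where s'': "(s', s'') \<in> Axiom" using Axiom_ex by blast
  obtain s3 where s3: "(s, s'', s3) \<in> Rule" using Rule_ex by blast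
  \<comment> \<open>The abstraction of \<open>T\<close> gets the constant codomain
    \<open>Sort s'\<close>, which needs the next sort \<open>s''\<close>; the congruence rule then
    ends in \<open>Sort s'\<close> whatever the argument.\<close>
  have P: "\<Gamma> \<turnstile> Pi r U s s'' (Sort s') : Sort s3"
    using ty_pi[OF U ty_sort s3] typing_wf(2)[OF T] s'' by blast
  have "\<Gamma> \<turnstile> App r (Lam r U T) u = App r (Lam r U T) u' : (Sort s')\<langle>u\<rangle>"
    using u by (intro eq_app[OF eq_refl[OF ty_lam[OF T P]]]) auto
  moreover have "(Sort s')\<langle>v\<rangle> = Sort s'" for v by (simp add: subst1_eq)
  ultimately show ?thesis
    using eq_beta[OF T u(1)] eq_beta[OF T u(2)] by (metis eq_sym eq_trans)
qed

text \<open>The work is in the right-hand sides: that of \<open>eq_lam\<close> naturally lives in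
  the function type over \<open>U'\<close>, and that of an application in
  \<open>T\<langle>u'\<rangle>\<close>. \<open>ctx_conversion\<close> and
  \<open>eq_subst1_type\<close> bring them back to the stated type.\<close>

lemma syntactic_validity:
  "\<turnstile> \<Gamma> \<Longrightarrow> True"
  "\<Gamma> \<turnstile> t : T \<Longrightarrow> \<exists>s. \<Gamma> \<turnstile> T : Sort s"
  "\<Gamma> \<turnstile> t = t' : T \<Longrightarrow> (\<exists>s. \<Gamma> \<turnstile> T : Sort s) \<and> \<Gamma> \<turnstile> t : T \<and> \<Gamma> \<turnstile> t' : T"
proof (induction rule: wf_ctx_has_type_eq_type.inducts)
  case (ty_sort \<Gamma> s s')
  then show ?case using Axiom_ex wf_ctx_has_type_eq_type.ty_sort by blast
next
  case (ty_pi \<Gamma> U s1 r T s2 s3)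
  then show ?case using Axiom_ex wf_ctx_has_type_eq_type.ty_sort typing_wf(2) by blast
next
  case (ty_var \<Gamma> i U)
  then have "\<exists>s. drop (Suc i) \<Gamma> \<turnstile> U : Sort s"
  proof (induction i arbitrary: \<Gamma>)
    case 0
    then show ?case by (cases \<Gamma>) (auto dest: wf_ConsD)
  next
    case (Suc i)
    then show ?case by (cases \<Gamma>) (auto dest: wf_ConsD)
  qed
  moreover have "ren_ok \<Gamma> (\<lambda>j. j + Suc i) (drop (Suc i) \<Gamma>)"
    using ty_var.hyps by (auto simp: ren_ok_def rename_rename comp_def add.commute algebra_simps)
  ultimately show ?case
    using renaming.typing[of "drop (Suc i) \<Gamma>" U _ \<Gamma> "Var \<circ> (\<lambda>j. j + Suc i)"] ty_var.hyps(1)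
    unfolding rename_eq_subst by fastforce
next
  case (ty_app \<Gamma> t r U s s' T u)
  then obtain s'' where "\<Gamma> \<turnstile> Pi r U s s' T : Sort s''" by blast
  from subst1_typing[OF pi_inv(2)[OF this] ty_app.hyps(2)] show ?case
    by (auto simp: subst1_eq)
next
  case (eq_beta r U \<Gamma> t T u)
  then obtain s' where T: "(r, U) # \<Gamma> \<turnstile> T : Sort s'" by blast
  obtain s where U: "\<Gamma> \<turnstile> U : Sort s"
    using wf_ConsD typing_wf(2) T by blast
  obtain s3 where s3: "(s, s', s3) \<in> Rule" using Rule_ex by blast
  have "\<Gamma> \<turnstile> App r (Lam r U t) u : T\<langle>u\<rangle>"
    by (rule wf_ctx_has_type_eq_type.ty_app[OF wf_ctx_has_type_eq_type.ty_lam[OF _ ty_pi[OF U T s3]]])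
      (use eq_beta in auto)
  moreover have "\<Gamma> \<turnstile> t\<langle>u\<rangle> : T\<langle>u\<rangle>" "\<Gamma> \<turnstile> T\<langle>u\<rangle> : Sort s'"
    using subst1_typing[OF eq_beta.hyps] subst1_typing[OF T eq_beta.hyps(2)]
    by (auto simp: subst1_eq)
  ultimately show ?case by blast
next
  case (eq_eta \<Gamma> t r U s s' T)
  then obtain s'' where P: "\<Gamma> \<turnstile> Pi r U s s' T : Sort s''" by blast
  have wf: "\<turnstile> (r, U) # \<Gamma>" using pi_inv(2)[OF P] typing_wf(2) by blast
  have t: "(r, U) # \<Gamma> \<turnstile> wk 1 t : Pi r (wk 1 U) s s' (rename (up_ren Suc) T)"
    using wk_typing[OF eq_eta.hyps wf] by simp
  \<comment> \<open>Weakening \<open>t\<close> has weakened \<open>T\<close> underneath its own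
    binder; instantiating with the bound variable undoes this.\<close>
  have "(rename (up_ren Suc) T)\<langle>Var 0\<rangle> = T"
  proof -
    have "case_nat (Var 0) Var \<circ> up_ren Suc = Var"
    proof
      show "(case_nat (Var 0) Var \<circ> up_ren Suc) i = Var i" for i by (cases i) auto
    qed
    then show ?thesis by (simp add: subst1_eq subst_rename subst_Var)
  qed
  then have "(r, U) # \<Gamma> \<turnstile> App r (wk 1 t) (Var 0) : T"
    using wf_ctx_has_type_eq_type.ty_app[OF t bound_var_typing[OF wf]] by simp
  then show ?case using P eq_eta.hyps wf_ctx_has_type_eq_type.ty_lam by blast
next
  case (eq_pi \<Gamma> U U' s1 r T T' s2 s3)
  then have "(r, U') # \<Gamma> \<turnstile> T' : Sort s2"
    using ctx_conversion by blast
  then show ?case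
    using eq_pi Axiom_ex wf_ctx_has_type_eq_type.ty_sort wf_ctx_has_type_eq_type.ty_pi typing_wf(2)
    by meson
next
  case (eq_lam \<Gamma> U U' s1 r T s2 t t')
  obtain s3 where s3: "(s1, s2, s3) \<in> Rule" using Rule_ex by blast
  have U: "\<Gamma> \<turnstile> U : Sort s1" "\<Gamma> \<turnstile> U' : Sort s1" using eq_lam by auto
  have P: "\<Gamma> \<turnstile> Pi r U s1 s2 T : Sort s3"
    using ty_pi[OF U(1) eq_lam.hyps(2) s3] .
  have P': "\<Gamma> \<turnstile> Pi r U' s1 s2 T : Sort s3"
    using ty_pi[OF U(2) ctx_conversion[OF U(2) eq_lam.hyps(1,2)] s3] .
  have "\<Gamma> \<turnstile> Pi r U' s1 s2 T = Pi r U s1 s2 T : Sort s3"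
    using wf_ctx_has_type_eq_type.eq_pi[OF eq_lam.hyps(1) eq_refl[OF eq_lam.hyps(2)] s3] eq_sym by blast
  moreover have "\<Gamma> \<turnstile> Lam r U' t' : Pi r U' s1 s2 T"
    using wf_ctx_has_type_eq_type.ty_lam[OF _ P'] ctx_conversion[OF U(2) eq_lam.hyps(1)] eq_lam.IH by blast
  ultimately show ?case using P wf_ctx_has_type_eq_type.ty_lam[OF _ P] eq_lam.IH ty_conv by blast
next
  case (eq_app_rel \<Gamma> t t' U s s' T u u')
  then obtain s'' where P: "\<Gamma> \<turnstile> Pi Rel U s s' T : Sort s''" by blast
  have "\<Gamma> \<turnstile> T\<langle>u\<rangle> = T\<langle>u'\<rangle> : Sort s'"
    using eq_subst1_type[OF pi_inv(2)[OF P]] eq_app_rel by simp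
  moreover have "\<Gamma> \<turnstile> T\<langle>u\<rangle> : Sort s'"
    using subst1_typing[OF pi_inv(2)[OF P], of u] eq_app_rel.IH by (simp add: subst1_eq)
  ultimately show ?case
    using eq_app_rel.IH ty_app[where r = Rel, simplified] ty_conv eq_sym by meson
next
  case (eq_app_irr \<Gamma> t t' U s s' T u u')
  then obtain s'' where P: "\<Gamma> \<turnstile> Pi Irr U s s' T : Sort s''" by blast
  have "\<Gamma> \<turnstile> T\<langle>u\<rangle> = T\<langle>u'\<rangle> : Sort s'"
    using eq_subst1_type[OF pi_inv(2)[OF P]] eq_app_irr by simp
  moreover have "\<Gamma> \<turnstile> T\<langle>u\<rangle> : Sort s'"
    using subst1_typing[OF pi_inv(2)[OF P], of u] eq_app_irr.hyps by (simp add: subst1_eq)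
  ultimately show ?case
    using eq_app_irr ty_app[where r = Irr, simplified] ty_conv eq_sym by meson
qed (auto intro: wf_ctx_has_type_eq_type.ty_conv)

section \<open>Functionality\<close>

text \<open>Typing bounds the free variables. This serves the empty context, where the two
  substitutions are unconstrained and must still produce the same term.\<close>

lemma subst_cong_scoped:
  "\<Gamma> \<turnstile> t : T \<Longrightarrow> \<forall>i < length \<Gamma>. \<sigma> i = \<sigma>' i \<Longrightarrow> subst \<sigma> t = subst \<sigma>' t"
proof (induction \<Gamma> t T arbitrary: \<sigma> \<sigma>' rule: wf_ctx_has_type_eq_type.inducts(2)
    [where ?P1.0 = "\<lambda>_. True" and ?P3.0 = "\<lambda>_ _ _ _. True"])
  case (ty_pi \<Gamma> U s1 r T s2 s3)
  have "\<forall>i < length ((r, U) # \<Gamma>). up_subst \<sigma> i = up_subst \<sigma>' i"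
    using ty_pi.prems by (simp add: All_less_Suc2)
  from ty_pi.IH(2)[OF this] ty_pi.IH(1)[OF ty_pi.prems] show ?case by simp
next
  case (ty_lam r U \<Gamma> t T s s' s'')
  have "\<forall>i < length ((r, U) # \<Gamma>). up_subst \<sigma> i = up_subst \<sigma>' i"
    using ty_lam.prems by (simp add: All_less_Suc2)
  from ty_lam.IH(1)[OF this] ty_lam.IH(2)[OF ty_lam.prems] show ?case by simp
next
  case (ty_app \<Gamma> t r U s s' T u)
  have "\<forall>i < length (ann_ctx r \<Gamma>). \<sigma> i = \<sigma>' i" using ty_app.prems by simp
  from ty_app.IH(2)[OF this] ty_app.IH(1)[OF ty_app.prems] show ?case by simp
next
  case (ty_conv \<Gamma> t T T' s)
  then show ?case by blast
qed (simp_all only: simp_thms subst.simps)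

text \<open>Both values are typed at the \<open>\<sigma>\<close>-instance of the type; typing at the
  \<open>\<sigma>'\<close>-instance is derived by functionality in the shorter context. Irrelevant
  values are not compared with each other.\<close>

primrec eq_sub :: "ctx \<Rightarrow> ctx \<Rightarrow> (nat \<Rightarrow> expr) \<Rightarrow> (nat \<Rightarrow> expr) \<Rightarrow> bool" where
  "eq_sub \<Delta> [] \<sigma> \<sigma>' = True"
| "eq_sub \<Delta> (b # \<Gamma>) \<sigma> \<sigma>' = (eq_sub \<Delta> \<Gamma> (\<sigma> \<circ> Suc) (\<sigma>' \<circ> Suc) \<and>
     ann_ctx (fst b) \<Delta> \<turnstile> \<sigma> 0 : subst (\<sigma> \<circ> Suc) (snd b) \<and>
     ann_ctx (fst b) \<Delta> \<turnstile> \<sigma>' 0 : subst (\<sigma> \<circ> Suc) (snd b) \<and>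
     (fst b = Rel \<longrightarrow> \<Delta> \<turnstile> \<sigma> 0 = \<sigma>' 0 : subst (\<sigma> \<circ> Suc) (snd b)))"

lemma case_nat_tail: "case_nat (\<sigma> 0) (\<sigma> \<circ> Suc) = \<sigma>"
proof
  show "case_nat (\<sigma> 0) (\<sigma> \<circ> Suc) i = \<sigma> i" for i by (cases i) auto
qed

lemma subst_up_tail: "(subst (up_subst (\<sigma> \<circ> Suc)) t)\<langle>\<sigma> 0\<rangle> = subst \<sigma> t"
  by (simp only: subst_up_subst1 case_nat_tail)

text \<open>
  By induction on the context rather than on the derivation: abstract the last variable, use the
  statement for the shorter context, apply to the two values of the variable and \<open>\<beta>\<close>-reduce.
\<close>

lemma functionality_aux:
  assumes "\<turnstile> \<Delta>"
  shows "\<turnstile> \<Gamma> \<Longrightarrow> eq_sub \<Delta> \<Gamma> \<sigma> \<sigma>' \<Longrightarrow> sub_ok \<Delta> \<sigma> \<Gamma> \<and> sub_ok \<Delta> \<sigma>' \<Gamma> \<and>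
    (\<forall>t T. \<Gamma> \<turnstile> t : T \<longrightarrow> \<Delta> \<turnstile> subst \<sigma> t = subst \<sigma>' t : subst \<sigma> T)"
proof (induction \<Gamma> arbitrary: \<sigma> \<sigma>')
  case Nil
  have "\<Delta> \<turnstile> subst \<sigma> t = subst \<sigma>' t : subst \<sigma> T" if t: "[] \<turnstile> t : T" for t T
    using subst_cong_scoped[OF t, of \<sigma>' \<sigma>, simplified] eq_refl[OF substitution.typing[OF t assms sub_ok_Nil]]
    by simp
  then show ?case by (simp add: sub_ok_Nil)
next
  case (Cons b \<Gamma>)
  obtain r U where b: "b = (r, U)" by (cases b)
  define \<tau> \<tau>' where "\<tau> = \<sigma> \<circ> Suc" and "\<tau>' = \<sigma>' \<circ> Suc"
  obtain s where \<Gamma>: "\<turnstile> \<Gamma>" and U: "\<Gamma> \<turnstile> U : Sort s"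
    using Cons.prems(1) wf_ConsD unfolding b by blast
  have \<sigma>: "eq_sub \<Delta> \<Gamma> \<tau> \<tau>'" "ann_ctx r \<Delta> \<turnstile> \<sigma> 0 : subst \<tau> U" "ann_ctx r \<Delta> \<turnstile> \<sigma>' 0 : subst \<tau> U"
    "r = Rel \<Longrightarrow> \<Delta> \<turnstile> \<sigma> 0 = \<sigma>' 0 : subst \<tau> U"
    using Cons.prems(2) unfolding b \<tau>_def \<tau>'_def by auto
  note IH = Cons.IH[OF \<Gamma> \<sigma>(1)]
  have F: "\<Delta> \<turnstile> subst \<tau> t = subst \<tau>' t : subst \<tau> T" if "\<Gamma> \<turnstile> t : T" for t T
    using IH that by blast
  have UU: "\<Delta> \<turnstile> subst \<tau> U = subst \<tau>' U : Sort s"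
    using F[OF U] by simp
  have U': "\<Delta> \<turnstile> subst \<tau>' U : Sort s" using syntactic_validity(3)[OF UU] by blast
  have \<sigma>'0: "ann_ctx r \<Delta> \<turnstile> \<sigma>' 0 : subst \<tau>' U"
    using ty_conv[OF \<sigma>(3) ann_ctx_eq[OF UU]] .
  have ok: "sub_ok \<Delta> \<sigma> ((r, U) # \<Gamma>)" "sub_ok \<Delta> \<sigma>' ((r, U) # \<Gamma>)"
    using IH \<sigma>(2) \<sigma>'0 unfolding sub_ok_Cons \<tau>_def \<tau>'_def by blast+
  \<comment> \<open>The \<beta>-reduct on the right comes out at type
    \<open>subst \<sigma>' T\<close>, so equality of the two instances of \<open>T\<close> is
    assumed here. It is supplied below by applying \<open>step\<close> to \<open>T\<close> itself,
    whose type is a sort and hence unchanged by substitution.\<close>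
  have step: "\<Delta> \<turnstile> subst \<sigma> t = subst \<sigma>' t : subst \<sigma> T"
    if t: "(r, U) # \<Gamma> \<turnstile> t : T" and T: "(r, U) # \<Gamma> \<turnstile> T : Sort s'"
      and TT: "\<Delta> \<turnstile> subst \<sigma>' T = subst \<sigma> T : Sort s'" for t T s'
  proof -
    obtain s3 where s3: "(s, s', s3) \<in> Rule" using Rule_ex by blast
    have L: "\<Delta> \<turnstile> Lam r (subst \<tau> U) (subst (up_subst \<tau>) t) = Lam r (subst \<tau>' U) (subst (up_subst \<tau>') t) :
        Pi r (subst \<tau> U) s s' (subst (up_subst \<tau>) T)"
      using F[OF ty_lam[OF t ty_pi[OF U T s3]]] by simp
    have "\<Delta> \<turnstile> App r (Lam r (subst \<tau> U) (subst (up_subst \<tau>) t)) (\<sigma> 0) =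
        App r (Lam r (subst \<tau>' U) (subst (up_subst \<tau>') t)) (\<sigma>' 0) : (subst (up_subst \<tau>) T)\<langle>\<sigma> 0\<rangle>"
      by (rule eq_app[OF L]) (use \<sigma> in auto)
    then have 1: "\<Delta> \<turnstile> App r (Lam r (subst \<tau> U) (subst (up_subst \<tau>) t)) (\<sigma> 0) =
        App r (Lam r (subst \<tau>' U) (subst (up_subst \<tau>') t)) (\<sigma>' 0) : subst \<sigma> T"
      unfolding \<tau>_def subst_up_tail .
    have wf: "\<turnstile> (r, subst \<tau> U) # \<Delta>" "\<turnstile> (r, subst \<tau>' U) # \<Delta>"
      using wf_ext[OF assms] U' syntactic_validity(3)[OF UU] by blast+
    have t1: "(r, subst \<tau> U) # \<Delta> \<turnstile> subst (up_subst \<tau>) t : subst (up_subst \<tau>) T"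
      using substitution.typing[OF t wf(1) sub_ok_up[OF wf(1)]] IH by blast
    have t2: "(r, subst \<tau>' U) # \<Delta> \<turnstile> subst (up_subst \<tau>') t : subst (up_subst \<tau>') T"
      using substitution.typing[OF t wf(2) sub_ok_up[OF wf(2)]] IH by blast
    have 2: "\<Delta> \<turnstile> App r (Lam r (subst \<tau> U) (subst (up_subst \<tau>) t)) (\<sigma> 0) = subst \<sigma> t : subst \<sigma> T"
      using eq_beta[OF t1 \<sigma>(2)] unfolding \<tau>_def subst_up_tail .
    have "\<Delta> \<turnstile> App r (Lam r (subst \<tau>' U) (subst (up_subst \<tau>') t)) (\<sigma>' 0) = subst \<sigma>' t : subst \<sigma>' T"
      using eq_beta[OF t2 \<sigma>'0] unfolding \<tau>'_def subst_up_tail .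
    note 3 = eq_conv[OF this TT]
    show ?thesis by (rule eq_trans[OF eq_sym[OF 2] eq_trans[OF 1 3]])
  qed
  have "\<Delta> \<turnstile> subst \<sigma> t = subst \<sigma>' t : subst \<sigma> T" if t: "(r, U) # \<Gamma> \<turnstile> t : T" for t T
  proof -
    obtain s' where T: "(r, U) # \<Gamma> \<turnstile> T : Sort s'" using syntactic_validity(2)[OF t] by blast
    obtain s'' where s'': "(s', s'') \<in> Axiom" using Axiom_ex by blast
    have "\<Delta> \<turnstile> subst \<sigma> T = subst \<sigma>' T : subst \<sigma> (Sort s')"
      by (rule step[OF T ty_sort[OF typing_wf(2)[OF T] s'']])
        (use eq_refl[OF ty_sort[OF assms s'']] in simp)
    then show ?thesis using step[OF t T] eq_sym by simp
  qed
  then show ?case using ok unfolding b by blast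
qed

lemma functionality_eq:
  assumes wf: "\<turnstile> \<Delta>" and \<sigma>: "eq_sub \<Delta> \<Gamma> \<sigma> \<sigma>'" and t: "\<Gamma> \<turnstile> t = t' : T"
  shows "\<Delta> \<turnstile> subst \<sigma> t = subst \<sigma>' t' : subst \<sigma> T"
proof -
  note F = functionality_aux[OF wf typing_wf(3)[OF t] \<sigma>]
  have "\<Delta> \<turnstile> subst \<sigma> t' = subst \<sigma>' t' : subst \<sigma> T"
    using F syntactic_validity(3)[OF t] by blast
  then show ?thesis
    using eq_trans[OF substitution.equality[OF t wf]] F by blast
qed

section \<open>Weak head evaluation\<close>

inductive_cases neutral_AppE: "neutral (App r t u)"
inductive_cases neutral_LamE: "neutral (Lam r U t)"
inductive_cases whe_SortE: "Sort s \<Down> a"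
inductive_cases whe_PiE: "Pi r U s s' T \<Down> a"
inductive_cases whe_LamE: "Lam r U t \<Down> a"

lemma whnf_App: "whnf (App r t u) \<longleftrightarrow> neutral t"
  by (auto elim: whnf.cases neutral_AppE intro: whnf.intros neutral.intros)

lemma whe_neutral: "neutral n \<Longrightarrow> n \<Down> n"
  by (intro whe_whnf whnf.intros)

lemma neutral_whe: "n \<Down> a \<Longrightarrow> neutral n \<Longrightarrow> a = n"
  "n @\<^bsup>r\<^esup> u \<Down> a \<Longrightarrow> neutral n \<Longrightarrow> a = App r n u"
  by (induction rule: whe_act_app.inducts) (auto elim: neutral_AppE neutral_LamE)

lemma whnf_whe: "whnf a \<Longrightarrow> a \<Down> b \<Longrightarrow> b = a"
  by (induction rule: whnf.induct) (auto elim: whe_SortE whe_PiE whe_LamE dest: neutral_whe)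

text \<open>The two rules \<open>whe_whnf\<close> and \<open>whe_app\<close> overlap on neutral
  applications only, and \<open>neutral_whe\<close> shows that both return the application
  itself.\<close>

lemma whe_det:
  "t \<Down> a \<Longrightarrow> t \<Down> b \<Longrightarrow> a = b"
  "f @\<^bsup>r\<^esup> u \<Down> a \<Longrightarrow> f @\<^bsup>r\<^esup> u \<Down> b \<Longrightarrow> a = b"
proof (induction arbitrary: b and b rule: whe_act_app.inducts)
  case (whe_whnf a)
  then show ?case using whnf_whe by blast
next
  case (whe_app t f r u a)
  from whe_app.prems show ?case
  proof cases
    case whe_whnf
    then have "neutral t" by (simp add: whnf_App)
    then show ?thesis using whe_app.hyps neutral_whe whe_whnf by blast
  next
    case (whe_app g)
    then show ?thesis using whe_app.IH by blast
  qed
next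
  case (act_lam t u a r U)
  from act_lam.prems act_lam.IH show ?case
    by cases (auto elim: neutral_LamE)
next
  case (act_ne n r u)
  then show ?case using neutral_whe(2) by blast
qed

text \<open>Evaluation is big-step, so head expansion is expressed as inheriting all values; this
  lemma carries it through an application.\<close>

lemma whe_App_mono:
  assumes t: "\<And>v. t \<Down> v \<Longrightarrow> t' \<Down> v" and "App r t u \<Down> v"
  shows "App r t' u \<Down> v"
  using assms(2)
proof cases
  case whe_whnf
  then have n: "neutral t" by (simp add: whnf_App)
  show ?thesis
    unfolding whe_whnf(1) by (rule whe_app[OF t[OF whe_neutral[OF n]] act_ne[OF n]])
next
  case (whe_app f)
  show ?thesis by (rule whe_act_app.whe_app[OF t[OF whe_app(1)] whe_app(2)])
qed

lemma whe_beta: "t\<langle>u\<rangle> \<Down> v \<Longrightarrow> App r (Lam r U t) u \<Down> v"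
  by (rule whe_app[OF whe_whnf[OF whnf.intros(3)] act_lam])

section \<open>The logical relation\<close>

abbreviation univ :: "nat \<Rightarrow> expr" where
  "univ k \<equiv> Sort (Set k)"

locale target =
  fixes D :: ctx
  assumes wf_D: "\<turnstile> D"
begin

definition WN :: "expr \<Rightarrow> expr \<Rightarrow> bool" where
  "WN A t \<longleftrightarrow> (\<exists>a. whnf a \<and> t \<Down> a \<and> D \<turnstile> t = a : A)"

definition arg :: "ann \<Rightarrow> expr \<Rightarrow> (expr \<Rightarrow> expr \<Rightarrow> bool) \<Rightarrow> expr \<Rightarrow> expr \<Rightarrow> bool" where
  "arg r U RU u u' \<longleftrightarrow> (case r of Rel \<Rightarrow> RU u u' | Irr \<Rightarrow> D\<^sup>\<oplus> \<turnstile> u : U \<and> D\<^sup>\<oplus> \<turnstile> u' : U)"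

text \<open>The relation at a neutral type: beyond judgemental equality and evaluation nothing is
  asked, in particular the values need not be neutral.\<close>

definition ne_rel :: "expr \<Rightarrow> expr \<Rightarrow> expr \<Rightarrow> bool" where
  "ne_rel A t t' \<longleftrightarrow> D \<turnstile> t = t' : A \<and> WN A t \<and> WN A t'"

text \<open>\<open>WN\<close> is demanded outright, as \<open>D\<close> offers no fresh variable on
  which a function could be tested. \<open>RT\<close> is indexed by the left argument; that related
  arguments give the same relation is proved within \<open>LR_main\<close>.\<close>

definition pi_rel :: "expr \<Rightarrow> ann \<Rightarrow> expr \<Rightarrow> (expr \<Rightarrow> expr \<Rightarrow> bool) \<Rightarrow> (expr \<Rightarrow> expr \<Rightarrow> expr \<Rightarrow> bool) \<Rightarrow>
    expr \<Rightarrow> expr \<Rightarrow> bool" where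
  "pi_rel A r U RU RT f f' \<longleftrightarrow> D \<turnstile> f = f' : A \<and> WN A f \<and> WN A f' \<and>
     (\<forall>u u'. arg r U RU u u' \<longrightarrow> RT u (App r f u) (App r f' u'))"

text \<open>
  Induction-recursion as an inductive graph: \<open>LR L k A B R\<close> says that \<open>A\<close> and \<open>B\<close> are equal reducible
  types of level \<open>k\<close> whose elements are related by \<open>R\<close>, where \<open>L j\<close> interprets the universes of
  level \<open>j < k\<close>.
\<close>

inductive LR :: "(nat \<Rightarrow> expr \<Rightarrow> expr \<Rightarrow> bool) \<Rightarrow> nat \<Rightarrow> expr \<Rightarrow> expr \<Rightarrow> (expr \<Rightarrow> expr \<Rightarrow> bool) \<Rightarrow> bool"
  for L where
  LR_ne: "A \<Down> N \<Longrightarrow> B \<Down> N' \<Longrightarrow> neutral N \<Longrightarrow> neutral N' \<Longrightarrow>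
    D \<turnstile> A = N : univ k \<Longrightarrow> D \<turnstile> B = N' : univ k \<Longrightarrow> D \<turnstile> A = B : univ k \<Longrightarrow>
    LR L k A B (ne_rel A)"
| LR_sort: "A \<Down> univ j \<Longrightarrow> B \<Down> univ j \<Longrightarrow>
    D \<turnstile> A = univ j : univ (Suc j) \<Longrightarrow> D \<turnstile> B = univ j : univ (Suc j) \<Longrightarrow>
    LR L (Suc j) A B (L j)"
| LR_pi: "A \<Down> Pi r U (Set i) (Set j) T \<Longrightarrow> B \<Down> Pi r U' (Set i) (Set j) T' \<Longrightarrow>
    D \<turnstile> A = Pi r U (Set i) (Set j) T : univ (max i j) \<Longrightarrow>
    D \<turnstile> B = Pi r U' (Set i) (Set j) T' : univ (max i j) \<Longrightarrow>
    D \<turnstile> A = B : univ (max i j) \<Longrightarrow>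
    LR L i U U' RU \<Longrightarrow>
    (\<And>u u'. arg r U RU u u' \<Longrightarrow> LR L j (T\<langle>u\<rangle>) (T'\<langle>u'\<rangle>) (RT u)) \<Longrightarrow>
    LR L (max i j) A B (pi_rel A r U RU RT)"

text \<open>Reducibility candidates for partial equivalence relations. Evaluation and expansion are
  stated on the left only; symmetry gives the right. Neutral terms are accepted as soon as they are
  judgementally equal, without comparing their structure.\<close>

definition cand :: "expr \<Rightarrow> (expr \<Rightarrow> expr \<Rightarrow> bool) \<Rightarrow> bool" where
  "cand A R \<longleftrightarrow> symp R \<and> transp R \<and>
     (\<forall>a b. R a b \<longrightarrow> D \<turnstile> a = b : A \<and> WN A a) \<and>
     (\<forall>n n'. neutral n \<longrightarrow> neutral n' \<longrightarrow> D \<turnstile> n = n' : A \<longrightarrow> R n n') \<and>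
     (\<forall>a b c. R a b \<longrightarrow> (\<forall>v. a \<Down> v \<longrightarrow> c \<Down> v) \<longrightarrow> D \<turnstile> c = a : A \<longrightarrow> R c b)"

lemmas candD =
  cand_def[THEN iffD1, THEN conjunct1]
  cand_def[THEN iffD1, THEN conjunct2, THEN conjunct1]
  cand_def[THEN iffD1, THEN conjunct2, THEN conjunct2, THEN conjunct1]
  cand_def[THEN iffD1, THEN conjunct2, THEN conjunct2, THEN conjunct2, THEN conjunct1]
  cand_def[THEN iffD1, THEN conjunct2, THEN conjunct2, THEN conjunct2, THEN conjunct2]

lemma cand_sym: "cand A R \<Longrightarrow> R a b \<Longrightarrow> R b a"
  by (rule sympD[OF candD(1)])

lemma cand_trans: "cand A R \<Longrightarrow> R a b \<Longrightarrow> R b c \<Longrightarrow> R a c"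
  by (rule transpD[OF candD(2)])

lemma cand_eq: "cand A R \<Longrightarrow> R a b \<Longrightarrow> D \<turnstile> a = b : A"
  using candD(3)[of A R] by blast

lemma cand_WN: "cand A R \<Longrightarrow> R a b \<Longrightarrow> WN A a"
  using candD(3)[of A R] by blast

lemma cand_neutral: "cand A R \<Longrightarrow> neutral n \<Longrightarrow> neutral n' \<Longrightarrow> D \<turnstile> n = n' : A \<Longrightarrow> R n n'"
  using candD(4)[of A R] by blast

lemma cand_expand: "cand A R \<Longrightarrow> R a b \<Longrightarrow> (\<And>v. a \<Down> v \<Longrightarrow> c \<Down> v) \<Longrightarrow> D \<turnstile> c = a : A \<Longrightarrow> R c b"
  using candD(5)[of A R, rule_format, of a b c] by blast

lemma eq_typed: "D \<turnstile> t = t' : A \<Longrightarrow> D \<turnstile> t : A \<and> D \<turnstile> t' : A"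
  using syntactic_validity(3) by blast

lemma WN_neutral: "neutral n \<Longrightarrow> D \<turnstile> n : A \<Longrightarrow> WN A n"
  unfolding WN_def by (rule exI[of _ n]) (simp add: whe_neutral whnf.intros(4) eq_refl)

lemma WN_expand: "WN A a \<Longrightarrow> (\<And>v. a \<Down> v \<Longrightarrow> c \<Down> v) \<Longrightarrow> D \<turnstile> c = a : A \<Longrightarrow> WN A c"
  unfolding WN_def by (blast intro: eq_trans)

lemma WN_conv: "WN A a \<Longrightarrow> D \<turnstile> A = B : Sort s \<Longrightarrow> WN B a"
  unfolding WN_def by (blast intro: eq_conv)

lemma eq_conv_iff: "D \<turnstile> A = B : Sort s \<Longrightarrow> (D \<turnstile> t = t' : A) = (D \<turnstile> t = t' : B)"
  by (rule iffI) (erule eq_conv, assumption, erule eq_conv, erule eq_sym)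

lemma WN_conv_iff: "D \<turnstile> A = B : Sort s \<Longrightarrow> WN A = WN B"
  by (intro ext iffI) (erule WN_conv, assumption, erule WN_conv, erule eq_sym)

lemma cand_conv:
  assumes "cand A R" "D \<turnstile> A = B : Sort s"
  shows "cand B R"
  using assms(1) unfolding cand_def eq_conv_iff[OF assms(2)] WN_conv_iff[OF assms(2)] .

lemma ne_rel_conv:
  assumes "D \<turnstile> A = B : Sort s"
  shows "ne_rel A = ne_rel B"
  by (intro ext) (simp only: ne_rel_def eq_conv_iff[OF assms] WN_conv_iff[OF assms])

lemma pi_rel_conv:
  assumes "D \<turnstile> A = B : Sort s"
  shows "pi_rel A r U RU RT = pi_rel B r U RU RT"
  by (intro ext) (simp only: pi_rel_def eq_conv_iff[OF assms] WN_conv_iff[OF assms])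

section \<open>Candidates at neutral and function types\<close>

lemma cand_ne: "cand A (ne_rel A)"
  unfolding cand_def
proof (intro conjI allI impI)
  show "symp (ne_rel A)" by (auto simp: symp_def ne_rel_def intro: eq_sym)
  show "transp (ne_rel A)" unfolding transp_def ne_rel_def by (blast intro: eq_trans)
  show "D \<turnstile> a = b : A" "WN A a" if "ne_rel A a b" for a b
    using that by (auto simp: ne_rel_def)
  show "ne_rel A n n'" if "neutral n" "neutral n'" "D \<turnstile> n = n' : A" for n n'
    using that WN_neutral eq_typed[OF that(3)] by (simp add: ne_rel_def)
  show "ne_rel A c b" if "ne_rel A a b" "\<forall>v. a \<Down> v \<longrightarrow> c \<Down> v" "D \<turnstile> c = a : A" for a b c
    using that WN_expand[of A a c] eq_trans[of D c a A b] by (simp add: ne_rel_def)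
qed

lemma arg_conv:
  assumes "D \<turnstile> U = U' : Sort s"
  shows "arg r U RU = arg r U' RU"
proof -
  have e: "D\<^sup>\<oplus> \<turnstile> U = U' : Sort s" using ann_ctx_eq[OF assms, of Irr] by simp
  have "(D\<^sup>\<oplus> \<turnstile> u : U) = (D\<^sup>\<oplus> \<turnstile> u : U')" for u
    using ty_conv[OF _ e] ty_conv[OF _ eq_sym[OF e]] by blast
  then show ?thesis by (cases r) (simp_all add: arg_def fun_eq_iff)
qed

lemma arg_sym: "cand U RU \<Longrightarrow> arg r U RU u u' \<Longrightarrow> arg r U RU u' u"
  using cand_sym[of U RU u u'] by (cases r) (auto simp: arg_def)

lemma arg_refl: "cand U RU \<Longrightarrow> arg r U RU u u' \<Longrightarrow> arg r U RU u u"
  using cand_trans[of U RU u u' u] cand_sym[of U RU u u'] by (cases r) (auto simp: arg_def)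

text \<open>Families such as \<open>RT\<close> are meaningful only on arguments in the domain, so
  they cannot be identified as functions; agreement on reflexive arguments is enough because a
  related pair has a reflexive left member.\<close>

lemma pi_rel_cong:
  assumes "cand U RU" and "arg r U' RU' = arg r U RU" and "\<And>u. arg r U RU u u \<Longrightarrow> RT u = RT' u"
  shows "pi_rel A r U RU RT = pi_rel A r U' RU' RT'"
proof -
  have "RT u = RT' u" if "arg r U RU u u'" for u u'
    using assms(3)[OF arg_refl[OF assms(1) that]] .
  then show ?thesis by (intro ext) (simp add: pi_rel_def assms(2) cong: imp_cong)
qed

lemma arg_typed: "cand U RU \<Longrightarrow> arg r U RU u u' \<Longrightarrow>
    ann_ctx r D \<turnstile> u : U \<and> ann_ctx r D \<turnstile> u' : U \<and> (r = Rel \<longrightarrow> D \<turnstile> u = u' : U)"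
  using cand_eq[of U RU u u'] eq_typed[of u u' U] by (cases r) (auto simp: arg_def)

text \<open>Each closure property is inherited pointwise from the codomain: applications of neutral
  terms are neutral, and \<open>whe_App_mono\<close> expands under the argument. Symmetry exchanges
  the arguments, hence the hypothesis that \<open>RT\<close> does not distinguish related
  ones.\<close>

lemma cand_pi:
  assumes A: "D \<turnstile> A = Pi r U s s' T : Sort s''"
    and U: "cand U RU"
    and T: "\<And>u u'. arg r U RU u u' \<Longrightarrow> cand (T\<langle>u\<rangle>) (RT u)"
    and RT: "\<And>u u'. arg r U RU u u' \<Longrightarrow> RT u = RT u'"
  shows "cand A (pi_rel A r U RU RT)"
proof -
  have app: "D \<turnstile> App r f u = App r f' u' : T\<langle>u\<rangle>" if "D \<turnstile> f = f' : A" "arg r U RU u u'" for f f' u u'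
    using arg_typed[OF U that(2)] that(1) eq_conv_iff[OF A] by (intro eq_app) auto
  show ?thesis
    unfolding cand_def
  proof (intro conjI allI impI)
    show "symp (pi_rel A r U RU RT)"
    proof (rule sympI)
      fix f f' assume f: "pi_rel A r U RU RT f f'"
      have "RT u (App r f' u) (App r f u')" if u: "arg r U RU u u'" for u u'
      proof -
        have "RT u' (App r f u') (App r f' u)" using f arg_sym[OF U u] by (simp add: pi_rel_def)
        then show ?thesis using RT[OF u] cand_sym[OF T[OF u]] by simp
      qed
      then show "pi_rel A r U RU RT f' f" using f eq_sym by (simp add: pi_rel_def)
    qed
    show "transp (pi_rel A r U RU RT)"
    proof (rule transpI)
      fix f f' f'' assume f: "pi_rel A r U RU RT f f'" and f': "pi_rel A r U RU RT f' f''"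
      have "RT u (App r f u) (App r f'' u')" if u: "arg r U RU u u'" for u u'
        \<comment> \<open>The first step is taken at the pair \<open>u\<close>, \<open>u\<close>, so
          that both steps lie in \<open>RT u\<close>.\<close>
        by (rule cand_trans[OF T[OF u], of _ "App r f' u"]) (use f f' u arg_refl[OF U u] in \<open>auto simp: pi_rel_def\<close>)
      then show "pi_rel A r U RU RT f f''" using f f' eq_trans[of D f f' A f''] by (simp add: pi_rel_def)
    qed
    show "D \<turnstile> a = b : A" "WN A a" if "pi_rel A r U RU RT a b" for a b
      using that by (auto simp: pi_rel_def)
    show "pi_rel A r U RU RT n n'" if n: "neutral n" "neutral n'" "D \<turnstile> n = n' : A" for n n'
    proof -
      have "RT u (App r n u) (App r n' u')" if u: "arg r U RU u u'" for u u'
        using cand_neutral[OF T[OF u]] app[OF n(3) u] n neutral.intros(2) by blast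
      then show ?thesis using n WN_neutral eq_typed[OF n(3)] by (simp add: pi_rel_def)
    qed
    show "pi_rel A r U RU RT c b"
      if a: "pi_rel A r U RU RT a b" "\<forall>v. a \<Down> v \<longrightarrow> c \<Down> v" "D \<turnstile> c = a : A" for a b c
    proof -
      have "RT u (App r c u) (App r b u')" if u: "arg r U RU u u'" for u u'
      proof (rule cand_expand[OF T[OF u]])
        show "RT u (App r a u) (App r b u')" using a(1) u by (simp add: pi_rel_def)
        show "App r c u \<Down> v" if "App r a u \<Down> v" for v
          using whe_App_mono[OF _ that] a(2) by blast
        show "D \<turnstile> App r c u = App r a u : T\<langle>u\<rangle>"
          using app[OF a(3) arg_refl[OF U u]] .
      qed
      moreover have "WN A c" by (rule WN_expand[of _ a]) (use a in \<open>auto simp: pi_rel_def\<close>)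
      ultimately show ?thesis using a eq_trans[of D c a A b] by (simp add: pi_rel_def)
    qed
  qed
qed

section \<open>Inversion and uniqueness for reducible types\<close>

lemma LR_eq: "LR L k A B R \<Longrightarrow> D \<turnstile> A = B : univ k"
proof (induction rule: LR.cases)
  case (LR_sort A j B)
  then show ?case using eq_trans[OF _ eq_sym] by blast
qed auto

lemma LR_WN: "LR L k A B R \<Longrightarrow> WN (univ k) A"
  by (induction rule: LR.cases) (auto simp: WN_def intro: whnf.intros)

text \<open>By determinism of evaluation the weak head normal form of \<open>A\<close> decides which
  clause of \<open>LR\<close> applies; the same argument gives the two inversions that
  follow.\<close>

lemma LR_ne_inv:
  assumes "LR L k A B R" "A \<Down> N" "neutral N"
  shows "\<exists>N'. B \<Down> N' \<and> neutral N' \<and> D \<turnstile> A = N : univ k \<and> D \<turnstile> B = N' : univ k \<and> R = ne_rel A"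
  using assms(1)
proof cases
  case (LR_ne N1 N1')
  then show ?thesis using whe_det(1)[OF assms(2) LR_ne(2)] by blast
next
  case (LR_sort j)
  then show ?thesis using whe_det(1)[OF assms(2) LR_sort(3)] assms(3) by (auto elim: neutral.cases)
next
  case (LR_pi r U i j T U' T' RU RT)
  then show ?thesis using whe_det(1)[OF assms(2) LR_pi(3)] assms(3) by (auto elim: neutral.cases)
qed

lemma LR_sort_inv:
  assumes "LR L k A B R" "A \<Down> univ j"
  shows "k = Suc j \<and> B \<Down> univ j \<and> D \<turnstile> B = univ j : univ (Suc j) \<and> R = L j"
  using assms(1)
proof cases
  case (LR_ne N1 N1')
  then show ?thesis using whe_det(1)[OF assms(2) LR_ne(2)] by (auto elim: neutral.cases)
next
  case (LR_sort j')
  then show ?thesis using whe_det(1)[OF assms(2) LR_sort(3)] by auto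
next
  case (LR_pi r U i j T U' T' RU RT)
  then show ?thesis using whe_det(1)[OF assms(2) LR_pi(3)] by auto
qed

lemma LR_pi_inv:
  assumes "LR L k A B R" "A \<Down> Pi r U s s' T"
  obtains i j U' T' RU RT where "s = Set i" "s' = Set j" "k = max i j"
    "B \<Down> Pi r U' s s' T'" "D \<turnstile> A = Pi r U s s' T : univ k" "D \<turnstile> B = Pi r U' s s' T' : univ k"
    "LR L i U U' RU" "\<And>u u'. arg r U RU u u' \<Longrightarrow> LR L j (T\<langle>u\<rangle>) (T'\<langle>u'\<rangle>) (RT u)"
    "R = pi_rel A r U RU RT"
  using assms(1)
proof cases
  case (LR_ne N1 N1')
  then show ?thesis using whe_det(1)[OF assms(2) LR_ne(2)] by (auto elim: neutral.cases)
next
  case (LR_sort j')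
  then show ?thesis using whe_det(1)[OF assms(2) LR_sort(3)] by auto
next
  case (LR_pi r1 U1 i j T1 U' T' RU RT)
  have "r1 = r" "U1 = U" "s = Set i" "s' = Set j" "T1 = T"
    using whe_det(1)[OF assms(2) LR_pi(3)] by auto
  then show ?thesis using that LR_pi by blast
qed

text \<open>\<open>R\<close> is kept literally, although the neutral and function clauses mention
  the type: judgementally equal types carry the same equalities and the same
  \<open>WN\<close>.\<close>

lemma LR_expand:
  assumes "LR L k A B R" and A': "\<And>v. A \<Down> v \<Longrightarrow> A' \<Down> v" "D \<turnstile> A' = A : univ k"
  shows "LR L k A' B R"
  using assms(1)
proof cases
  case (LR_ne N1 N1')
  have "LR L k A' B (ne_rel A')"
    by (rule LR.LR_ne[of _ N1 _ N1']) (use LR_ne A' eq_trans in blast)+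
  then show ?thesis using LR_ne ne_rel_conv[OF A'(2)] by simp
next
  case (LR_sort j)
  have "D \<turnstile> A' = univ j : univ (Suc j)" using eq_trans LR_sort A'(2) by blast
  then show ?thesis using LR_sort A'(1) LR.LR_sort by blast
next
  case (LR_pi r U i j T U' T' RU RT)
  note A'2 = A'(2)[unfolded LR_pi(1)]
  have "LR L (max i j) A' B (pi_rel A' r U RU RT)"
    by (rule LR.LR_pi[OF A'(1)[OF LR_pi(3)] LR_pi(4) eq_trans[OF A'2 LR_pi(5)] LR_pi(6)
          eq_trans[OF A'2 LR_pi(7)] LR_pi(8) LR_pi(9)])
  then show ?thesis using LR_pi pi_rel_conv[OF A'(2)] by simp
qed

text \<open>
  The levels of the two relations in the last two conjuncts may differ, because a neutral type does not
  determine its level.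
\<close>

lemma LR_main:
  assumes "LR L k A B R" "\<forall>j < k. cand (univ j) (L j)"
  shows "cand A R \<and> LR L k B A R \<and>
    (\<forall>k' C R'. LR L k' B C R' \<longrightarrow> R' = R \<and> (k' = k \<longrightarrow> LR L k A C R)) \<and>
    (\<forall>k' C R'. LR L k' A C R' \<longrightarrow> R' = R)"
  using assms
proof (induction rule: LR.induct)
  case (LR_ne A N B N' k)
  have "LR L k B A (ne_rel A)"
    unfolding ne_rel_conv[OF LR_ne(7)]
    by (rule LR.LR_ne[OF LR_ne(2,1,4,3,6,5) eq_sym[OF LR_ne(7)]])
  moreover have "R' = ne_rel A \<and> (k' = k \<longrightarrow> LR L k A C (ne_rel A))" if C: "LR L k' B C R'" for k' C R'
  proof -
    obtain N'' where N'': "C \<Down> N''" "neutral N''" "D \<turnstile> C = N'' : univ k'" "R' = ne_rel B"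
      using LR_ne_inv[OF C LR_ne(2,4)] by blast
    have "LR L k A C (ne_rel A)" if "k' = k"
      by (rule LR.LR_ne[OF LR_ne(1) N''(1) LR_ne(3) N''(2) LR_ne(5) N''(3)[unfolded that]
            eq_trans[OF LR_ne(7) LR_eq[OF C, unfolded that]]])
    then show ?thesis using N'' ne_rel_conv[OF LR_ne(7)] by simp
  qed
  moreover have "R' = ne_rel A" if C: "LR L k' A C R'" for k' C R'
    using LR_ne_inv[OF C LR_ne(1,3)] by blast
  ultimately show ?case using cand_ne by blast
next
  case (LR_sort A j B)
  have "cand A (L j)"
    using LR_sort.prems cand_conv[OF _ eq_sym[OF LR_sort(3)]] by blast
  moreover have "LR L (Suc j) B A (L j)" by (rule LR.LR_sort[OF LR_sort(2,1,4,3)])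
  moreover have "R' = L j \<and> (k' = Suc j \<longrightarrow> LR L (Suc j) A C (L j))" if C: "LR L k' B C R'" for k' C R'
    using LR_sort_inv[OF C LR_sort(2)] LR.LR_sort[OF LR_sort(1) _ LR_sort(3)] by blast
  moreover have "R' = L j" if C: "LR L k' A C R'" for k' C R'
    using LR_sort_inv[OF C LR_sort(1)] by blast
  ultimately show ?case by blast
next
  case (LR_pi A r U i j T B U' T' RU RT)
  let ?A = "arg r U RU"
  have L: "\<forall>l<i. cand (univ l) (L l)" "\<forall>l<j. cand (univ l) (L l)"
    using LR_pi.prems by auto
  note IU = LR_pi.IH(1)[OF L(1)]
  have IU_sym: "LR L i U' U RU" and cU: "cand U RU" using IU by blast+
  have IU_trans: "R' = RU \<and> LR L i U C RU" if "LR L i U' C R'" for C R' using IU that by blast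
  have IU_fun: "R' = RU" if "LR L k' U C R'" for k' C R' using IU that by blast
  note IT = LR_pi.IH(2)[OF _ L(2)]
  have cT: "cand (T\<langle>u\<rangle>) (RT u)" and IT_sym: "LR L j (T'\<langle>u'\<rangle>) (T\<langle>u\<rangle>) (RT u)"
    if "?A u u'" for u u' using IT[OF that] by blast+
  have IT_trans: "R' = RT u \<and> LR L j (T\<langle>u\<rangle>) C (RT u)"
    if "?A u u'" "LR L j (T'\<langle>u'\<rangle>) C R'" for u u' C R'
    using IT[OF that(1)] that(2) by blast
  have IT_fun: "R' = RT u" if "?A u u'" "LR L k' (T\<langle>u\<rangle>) C R'" for u u' k' C R'
    using IT[OF that(1)] that(2) by blast
  have UU: "D \<turnstile> U = U' : univ i" using LR_eq[OF LR_pi.hyps(6)] .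
  have AA: "arg r U' RU = ?A" using arg_conv[OF UU] by simp
  have refl_right: "?A u' u'" if "?A u u'" for u u'
    using arg_refl[OF cU arg_sym[OF cU that]] .
  \<comment> \<open>\<open>T'\<langle>u'\<rangle>\<close> is paired with
    \<open>T\<langle>u'\<rangle>\<close> through \<open>RT u'\<close> and with
    \<open>T\<langle>u\<rangle>\<close> through \<open>RT u\<close>; uniqueness in the induction
    hypothesis identifies the two.\<close>
  have RT: "RT u = RT u'" if u: "?A u u'" for u u'
    using IT_trans[OF refl_right[OF u] IT_sym[OF u]] by blast
  have cA: "cand A (pi_rel A r U RU RT)"
    by (rule cand_pi[OF LR_pi.hyps(3) cU cT RT])
  have BA: "pi_rel B r U' RU RT = pi_rel A r U RU RT"
    unfolding pi_rel_conv[OF LR_pi.hyps(5)] by (rule sym, rule pi_rel_cong[OF cU AA refl])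
  have "LR L (max i j) B A (pi_rel B r U' RU RT)"
  proof (rule LR.LR_pi[OF LR_pi.hyps(2,1,4,3) eq_sym[OF LR_pi.hyps(5)] IU_sym])
    show "LR L j (T'\<langle>u\<rangle>) (T\<langle>u'\<rangle>) (RT u)" if "arg r U' RU u u'" for u u'
    proof -
      have u: "?A u' u" using arg_sym[OF cU that[unfolded AA]] .
      show ?thesis using IT_sym[OF u] unfolding RT[OF u] .
    qed
  qed
  then have BA: "LR L (max i j) B A (pi_rel A r U RU RT)" unfolding BA .
  have tr: "R' = pi_rel A r U RU RT \<and> (k' = max i j \<longrightarrow> LR L (max i j) A C (pi_rel A r U RU RT))"
    if C: "LR L k' B C R'" for k' C R'
    using C LR_pi.hyps(2)
  proof (rule LR_pi_inv)
    fix i' j' U'' T'' RU' RT'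
    assume s: "Set i = Set i'" "Set j = Set j'" and k': "k' = max i' j'"
      and CP: "C \<Down> Pi r U'' (Set i) (Set j) T''"
      and B: "D \<turnstile> B = Pi r U' (Set i) (Set j) T' : univ k'"
      and CE: "D \<turnstile> C = Pi r U'' (Set i) (Set j) T'' : univ k'"
      and U'': "LR L i' U' U'' RU'"
      and T'': "\<And>u u'. arg r U' RU' u u' \<Longrightarrow> LR L j' (T'\<langle>u\<rangle>) (T''\<langle>u'\<rangle>) (RT' u)"
      and R': "R' = pi_rel B r U' RU' RT'"
    have ij: "i' = i" "j' = j" using s by auto
    have RU': "RU' = RU" and U: "LR L i U U'' RU"
      using IU_trans[OF U''[unfolded ij]] by blast+
    have TT: "RT' u' = RT u" "LR L j (T\<langle>u\<rangle>) (T''\<langle>u'\<rangle>) (RT u)" if u: "?A u u'" for u u'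
    proof -
      \<comment> \<open>The passage from \<open>u\<close> to \<open>u'\<close> is left to the first
        derivation; the second is used only on the diagonal at \<open>u'\<close>, so that they meet
        in \<open>T'\<langle>u'\<rangle>\<close>.\<close>
      have "LR L j (T'\<langle>u'\<rangle>) (T''\<langle>u'\<rangle>) (RT' u')"
        using T''[unfolded RU' AA ij, OF refl_right[OF u]] .
      from IT_trans[OF u this]
      show "RT' u' = RT u" "LR L j (T\<langle>u\<rangle>) (T''\<langle>u'\<rangle>) (RT u)" by blast+
    qed
    have "arg r U' RU' = ?A" unfolding RU' by (rule AA)
    then have "pi_rel A r U RU RT = pi_rel A r U' RU' RT'"
      by (rule pi_rel_cong[OF cU]) (rule TT(1)[symmetric])
    then have "R' = pi_rel A r U RU RT"
      using R' pi_rel_conv[OF LR_pi.hyps(5)] by simp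
    moreover have "LR L (max i j) A C (pi_rel A r U RU RT)"
      by (rule LR.LR_pi[OF LR_pi.hyps(1) CP LR_pi.hyps(3) CE[unfolded k' ij]
            eq_trans[OF LR_pi.hyps(5) LR_eq[OF C, unfolded k' ij]] U TT(2)])
    ultimately show ?thesis by blast
  qed
  have "R' = pi_rel A r U RU RT" if C: "LR L k' A C R'" for k' C R'
    using C LR_pi.hyps(1)
  proof (rule LR_pi_inv)
    fix i' j' U'' T'' RU' RT'
    assume U'': "LR L i' U U'' RU'"
      and T'': "\<And>u u'. arg r U RU' u u' \<Longrightarrow> LR L j' (T\<langle>u\<rangle>) (T''\<langle>u'\<rangle>) (RT' u)"
      and R': "R' = pi_rel A r U RU' RT'"
    have RU': "RU' = RU" using IU_fun[OF U''] .
    have "RT u = RT' u" if u: "?A u u" for u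
      using IT_fun[OF u T''[unfolded RU', OF u]] by simp
    then have "pi_rel A r U RU RT = pi_rel A r U RU RT'"
      by (rule pi_rel_cong[OF cU refl])
    then show ?thesis unfolding R' RU' by simp
  qed
  then show ?case using cA BA tr by blast
qed

section \<open>The tower of universes\<close>

lemma LR_cong: "LR L k A B R \<Longrightarrow> \<forall>l < k. L l = L' l \<Longrightarrow> LR L' k A B R"
proof (induction rule: LR.induct)
  case (LR_ne A N B N' k)
  then show ?case by (blast intro: LR.LR_ne)
next
  case (LR_sort A j B)
  then show ?case using LR.LR_sort[of A j B L'] by simp
next
  case (LR_pi A r U i j T B U' T' RU RT)
  show ?case
    by (rule LR.LR_pi[OF LR_pi.hyps(1-5)]) (use LR_pi.IH LR_pi.prems in auto)
qed

text \<open>A table filled one entry per stage: stage \<open>k\<close> interprets the universes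
  below \<open>k\<close> and is empty elsewhere, and later stages never change an entry.\<close>

primrec levels :: "nat \<Rightarrow> nat \<Rightarrow> expr \<Rightarrow> expr \<Rightarrow> bool" where
  "levels 0 = (\<lambda>_ _ _. False)"
| "levels (Suc k) = (levels k)(k := \<lambda>A B. \<exists>R. LR (levels k) k A B R)"

definition ured :: "nat \<Rightarrow> expr \<Rightarrow> expr \<Rightarrow> bool" where
  "ured k = levels (Suc k) k"

lemma levels_eq: "l < k \<Longrightarrow> levels k l = ured l"
  by (induction k) (auto simp: ured_def less_Suc_eq)

abbreviation red :: "nat \<Rightarrow> expr \<Rightarrow> expr \<Rightarrow> (expr \<Rightarrow> expr \<Rightarrow> bool) \<Rightarrow> bool" where
  "red \<equiv> LR ured"

text \<open>\<open>LR\<close> at level \<open>k\<close> consults only entries below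
  \<open>k\<close>, so the partial table of stage \<open>k\<close> may be replaced by the full
  interpretation \<open>ured\<close>.\<close>

lemma ured_iff: "ured k A B \<longleftrightarrow> (\<exists>R. red k A B R)"
proof -
  have e: "\<forall>l<k. levels k l = ured l" "\<forall>l<k. ured l = levels k l"
    using levels_eq by simp_all
  have "LR (levels k) k A B = red k A B"
    by (intro ext iffI) (erule LR_cong, rule e)+
  then show ?thesis by (simp add: ured_def[of k])
qed

text \<open>\<open>LR_main\<close> at level \<open>k\<close> presupposes this at all lower levels,
  hence the strong induction. Afterwards that assumption is discharged for good in
  \<open>red_main\<close>.\<close>

lemma cand_ured: "cand (univ k) (ured k)"
proof (induction k rule: less_induct)
  case (less k)
  then have L: "\<forall>j<k. cand (univ j) (ured j)" by blast
  have sym: "red k B A R" if "red k A B R" for A B R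
    using LR_main[OF that L] by blast
  have trans: "red k A C R" if "red k A B R" "red k B C R'" for A B C R R'
    using LR_main[OF that(1) L] that(2) by blast
  show ?case
    unfolding cand_def
  proof (intro conjI allI impI)
    show "symp (ured k)"
    proof (rule sympI)
      fix A B assume "ured k A B"
      then obtain R where "red k A B R" using ured_iff by blast
      from sym[OF this] show "ured k B A" by (rule ured_iff[THEN iffD2, OF exI])
    qed
    show "transp (ured k)"
    proof (rule transpI)
      fix A B C assume "ured k A B" "ured k B C"
      then obtain R R' where "red k A B R" "red k B C R'" using ured_iff by blast
      from trans[OF this] show "ured k A C" by (rule ured_iff[THEN iffD2, OF exI])
    qed
    show "D \<turnstile> A = B : univ k" "WN (univ k) A" if AB: "ured k A B" for A B
    proof -
      obtain R where "red k A B R" using AB ured_iff by blast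
      then show "D \<turnstile> A = B : univ k" "WN (univ k) A" by (rule LR_eq, rule LR_WN)
    qed
    show "ured k n n'" if n: "neutral n" "neutral n'" "D \<turnstile> n = n' : univ k" for n n'
    proof -
      have "D \<turnstile> n = n : univ k" "D \<turnstile> n' = n' : univ k"
        using eq_typed[OF n(3)] eq_refl by simp_all
      from LR_ne[OF whe_neutral[OF n(1)] whe_neutral[OF n(2)] n(1,2) this n(3)]
      show ?thesis by (rule ured_iff[THEN iffD2, OF exI])
    qed
    show "ured k A' B" if AB: "ured k A B" and A': "\<forall>v. A \<Down> v \<longrightarrow> A' \<Down> v" "D \<turnstile> A' = A : univ k" for A B A'
    proof -
      obtain R where "red k A B R" using AB ured_iff by blast
      from LR_expand[OF this A'(1)[rule_format] A'(2)]
      show ?thesis by (rule ured_iff[THEN iffD2, OF exI])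
    qed
  qed
qed

lemma red_main:
  assumes "red k A B R"
  shows "cand A R \<and> red k B A R \<and>
    (\<forall>k' C R'. red k' B C R' \<longrightarrow> R' = R \<and> (k' = k \<longrightarrow> red k A C R)) \<and>
    (\<forall>k' C R'. red k' A C R' \<longrightarrow> R' = R)"
  using LR_main[OF assms] cand_ured by blast

lemma red_cand: "red k A B R \<Longrightarrow> cand A R"
  using red_main[of k A B R] by blast

lemma red_sym: "red k A B R \<Longrightarrow> red k B A R"
  using red_main[of k A B R] by blast

lemma red_trans: "red k A B R \<Longrightarrow> red k B C R' \<Longrightarrow> red k A C R"
  using red_main[of k A B R] by blast

text \<open>Every validity hypothesis delivers its own existentially quantified level and relation;
  this is what identifies the relations.\<close>

lemma red_fun: "red k A B R \<Longrightarrow> red k' A C R' \<Longrightarrow> R' = R"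
  using red_main[of k A B R] by blast

lemma red_refl: "red k A B R \<Longrightarrow> red k A A R"
  by (rule red_trans[OF _ red_sym])

section \<open>Fundamental lemma\<close>

text \<open>Unlike \<open>arg\<close>, no relation is fixed in advance: the two instances of the
  type must be reducible, and by \<open>red_fun\<close> their relation is unique. Irrelevant values
  are both typed at the left instance.\<close>

definition sem_arg :: "ann \<Rightarrow> expr \<Rightarrow> expr \<Rightarrow> expr \<Rightarrow> expr \<Rightarrow> bool" where
  "sem_arg r A A' u u' \<longleftrightarrow> (case r of Rel \<Rightarrow> \<exists>k R. red k A A' R \<and> R u u'
     | Irr \<Rightarrow> D\<^sup>\<oplus> \<turnstile> u : A \<and> D\<^sup>\<oplus> \<turnstile> u' : A)"

primrec sem_sub :: "ctx \<Rightarrow> (nat \<Rightarrow> expr) \<Rightarrow> (nat \<Rightarrow> expr) \<Rightarrow> bool" where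
  "sem_sub [] \<sigma> \<sigma>' = True"
| "sem_sub (b # \<Gamma>) \<sigma> \<sigma>' = (sem_sub \<Gamma> (\<sigma> \<circ> Suc) (\<sigma>' \<circ> Suc) \<and>
     sem_arg (fst b) (subst (\<sigma> \<circ> Suc) (snd b)) (subst (\<sigma>' \<circ> Suc) (snd b)) (\<sigma> 0) (\<sigma>' 0))"

text \<open>Reducibility of the type is bundled with that of the terms, so the fundamental lemma
  carries one statement and no separate notion of valid context.\<close>

definition valid :: "ctx \<Rightarrow> expr \<Rightarrow> expr \<Rightarrow> expr \<Rightarrow> bool" where
  "valid \<Gamma> t t' T \<longleftrightarrow> (\<forall>\<sigma> \<sigma>'. sem_sub \<Gamma> \<sigma> \<sigma>' \<longrightarrow>
     (\<exists>k R. red k (subst \<sigma> T) (subst \<sigma>' T) R \<and> R (subst \<sigma> t) (subst \<sigma>' t')))"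

lemma validE:
  assumes "valid \<Gamma> t t' T" "sem_sub \<Gamma> \<sigma> \<sigma>'"
  obtains k R where "red k (subst \<sigma> T) (subst \<sigma>' T) R" "R (subst \<sigma> t) (subst \<sigma>' t')"
  using assms unfolding valid_def by blast

lemma sem_sub_case_nat: "sem_sub ((r, U) # \<Gamma>) (case_nat u \<sigma>) (case_nat u' \<sigma>') \<longleftrightarrow>
    sem_sub \<Gamma> \<sigma> \<sigma>' \<and> sem_arg r (subst \<sigma> U) (subst \<sigma>' U) u u'"
  by (simp add: comp_def)

lemma red_refl_elem: "red k A B R \<Longrightarrow> R a b \<Longrightarrow> R a a"
  using cand_trans[OF red_cand] cand_sym[OF red_cand] by blast

lemma red_conv_right: "red k A B R \<Longrightarrow> cand B R"
  by (rule red_cand[OF red_sym])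

lemma arg_sem_arg: "red i U U' RU \<Longrightarrow> arg r U RU u u' \<Longrightarrow> sem_arg r U U' u u'"
  by (cases r) (auto simp: arg_def sem_arg_def)

lemma sem_arg_typed:
  assumes "sem_arg r U U' u u'"
  shows "ann_ctx r D \<turnstile> u : U" "ann_ctx r D \<turnstile> u' : U" "r = Rel \<Longrightarrow> D \<turnstile> u = u' : U"
proof -
  have *: "ann_ctx r D \<turnstile> u : U \<and> ann_ctx r D \<turnstile> u' : U \<and> (r = Rel \<longrightarrow> D \<turnstile> u = u' : U)"
  proof (cases r)
    case Rel
    then obtain k R where "red k U U' R" "R u u'" using assms by (auto simp: sem_arg_def)
    then have "D \<turnstile> u = u' : U" using cand_eq[OF red_cand] by blast
    then show ?thesis using eq_typed[of u u' U] Rel by simp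
  next
    case Irr
    then show ?thesis using assms by (simp add: sem_arg_def)
  qed
  show "ann_ctx r D \<turnstile> u : U" "ann_ctx r D \<turnstile> u' : U" "r = Rel \<Longrightarrow> D \<turnstile> u = u' : U"
    using * by simp_all
qed

lemma sem_arg_refl: "sem_arg r U U' u u' \<Longrightarrow> sem_arg r U U u u"
proof (cases r)
  case Rel
  assume "sem_arg r U U' u u'"
  then obtain k R where "red k U U' R" "R u u'" using Rel by (auto simp: sem_arg_def)
  then have "red k U U R" "R u u" using red_refl red_refl_elem by blast+
  then show ?thesis using Rel by (auto simp: sem_arg_def)
qed (simp add: sem_arg_def)

lemma sem_arg_sym:
  assumes "sem_arg r U U' u u'" "D \<turnstile> U = U' : Sort s"
  shows "sem_arg r U' U u' u"
proof (cases r)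
  case Rel
  then obtain k R where "red k U U' R" "R u u'" using assms(1) by (auto simp: sem_arg_def)
  then have "red k U' U R" "R u' u" using red_sym cand_sym[OF red_cand] by blast+
  then show ?thesis using Rel by (auto simp: sem_arg_def)
next
  case Irr
  have "D\<^sup>\<oplus> \<turnstile> U = U' : Sort s" using ann_ctx_eq[OF assms(2), of Irr] by simp
  from ty_conv[OF _ this] show ?thesis using assms(1) Irr by (simp add: sem_arg_def)
qed

lemma sem_sub_eq_sub: "sem_sub \<Gamma> \<sigma> \<sigma>' \<Longrightarrow> eq_sub D \<Gamma> \<sigma> \<sigma>'"
proof (induction \<Gamma> arbitrary: \<sigma> \<sigma>')
  case (Cons b \<Gamma>)
  then have "sem_sub \<Gamma> (\<sigma> \<circ> Suc) (\<sigma>' \<circ> Suc)"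
    and "sem_arg (fst b) (subst (\<sigma> \<circ> Suc) (snd b)) (subst (\<sigma>' \<circ> Suc) (snd b)) (\<sigma> 0) (\<sigma>' 0)"
    by simp_all
  from Cons.IH[OF this(1)] sem_arg_typed[OF this(2)] show ?case
    unfolding eq_sub.simps by blast
qed simp

lemma sem_sub_functionality:
  assumes "\<turnstile> \<Gamma>" "sem_sub \<Gamma> \<sigma> \<sigma>'"
  shows "sub_ok D \<sigma> \<Gamma>" "sub_ok D \<sigma>' \<Gamma>" "\<Gamma> \<turnstile> t : T \<Longrightarrow> D \<turnstile> subst \<sigma> t = subst \<sigma>' t : subst \<sigma> T"
  using functionality_aux[OF wf_D assms(1) sem_sub_eq_sub[OF assms(2)]] by blast+

lemma sem_sub_refl: "sem_sub \<Gamma> \<sigma> \<sigma>' \<Longrightarrow> sem_sub \<Gamma> \<sigma> \<sigma>"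
proof (induction \<Gamma> arbitrary: \<sigma> \<sigma>')
  case (Cons b \<Gamma>)
  from Cons.prems have "sem_sub \<Gamma> (\<sigma> \<circ> Suc) (\<sigma>' \<circ> Suc)"
    and "sem_arg (fst b) (subst (\<sigma> \<circ> Suc) (snd b)) (subst (\<sigma>' \<circ> Suc) (snd b)) (\<sigma> 0) (\<sigma>' 0)"
    by simp_all
  from Cons.IH[OF this(1)] sem_arg_refl[OF this(2)] show ?case by (simp only: sem_sub.simps simp_thms)
qed simp

text \<open>Irrelevant values are typed at the \<open>\<sigma>\<close>-instance and have to be
  retyped at the \<open>\<sigma>'\<close>-instance; this is functionality applied to the type,
  whence the well-formed context.\<close>

lemma sem_sub_sym: "\<turnstile> \<Gamma> \<Longrightarrow> sem_sub \<Gamma> \<sigma> \<sigma>' \<Longrightarrow> sem_sub \<Gamma> \<sigma>' \<sigma>"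
proof (induction \<Gamma> arbitrary: \<sigma> \<sigma>')
  case (Cons b \<Gamma>)
  obtain r U where b: "b = (r, U)" by (cases b)
  obtain s where \<Gamma>: "\<turnstile> \<Gamma>" and U: "\<Gamma> \<turnstile> U : Sort s"
    using Cons.prems(1) wf_ConsD unfolding b by blast
  from Cons.prems(2) have \<sigma>: "sem_sub \<Gamma> (\<sigma> \<circ> Suc) (\<sigma>' \<circ> Suc)"
    and a: "sem_arg r (subst (\<sigma> \<circ> Suc) U) (subst (\<sigma>' \<circ> Suc) U) (\<sigma> 0) (\<sigma>' 0)"
    unfolding b by simp_all
  have "D \<turnstile> subst (\<sigma> \<circ> Suc) U = subst (\<sigma>' \<circ> Suc) U : Sort s"
    using sem_sub_functionality(3)[OF \<Gamma> \<sigma> U] by simp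
  from sem_arg_sym[OF a this] Cons.IH[OF \<Gamma> \<sigma>] show ?case
    unfolding b by (simp only: sem_sub.simps simp_thms fst_conv snd_conv)
qed simp

lemma sem_sub_nth: "sem_sub \<Gamma> \<sigma> \<sigma>' \<Longrightarrow> i < length \<Gamma> \<Longrightarrow> \<Gamma> ! i = (Rel, U) \<Longrightarrow>
    \<exists>k R. red k (subst (\<lambda>j. \<sigma> (j + Suc i)) U) (subst (\<lambda>j. \<sigma>' (j + Suc i)) U) R \<and> R (\<sigma> i) (\<sigma>' i)"
proof (induction \<Gamma> arbitrary: i \<sigma> \<sigma>')
  case (Cons b \<Gamma>)
  show ?case
  proof (cases i)
    case 0
    then show ?thesis using Cons.prems by (simp add: sem_arg_def comp_def)
  next
    case (Suc j)
    have "sem_sub \<Gamma> (\<sigma> \<circ> Suc) (\<sigma>' \<circ> Suc)" "j < length \<Gamma>" "\<Gamma> ! j = (Rel, U)"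
      using Cons.prems Suc by simp_all
    from Cons.IH[OF this] show ?thesis by (simp add: Suc)
  qed
qed simp

lemma expand_left: "red k A B R \<Longrightarrow> R a b \<Longrightarrow> (\<And>v. a \<Down> v \<Longrightarrow> c \<Down> v) \<Longrightarrow> D \<turnstile> c = a : A \<Longrightarrow> R c b"
  by (rule cand_expand[OF red_cand])

lemma expand_right:
  assumes "red k A B R" "R a b" "\<And>v. b \<Down> v \<Longrightarrow> c \<Down> v" "D \<turnstile> c = b : B"
  shows "R a c"
proof -
  note B = red_conv_right[OF assms(1)]
  show ?thesis by (rule cand_sym[OF B cand_expand[OF B cand_sym[OF B assms(2)] assms(3,4)]])
qed

lemma red_univ: "red (Suc k) (univ k) (univ k) (ured k)"
proof -
  have "univ k \<Down> univ k" by (rule whe_whnf) (rule whnf.intros)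
  moreover have "D \<turnstile> univ k = univ k : univ (Suc k)"
    by (rule eq_refl, rule ty_sort[OF wf_D]) (simp add: Axiom_def)
  ultimately show ?thesis using LR_sort by blast
qed

text \<open>Whatever relation witnesses validity in \<open>univ k\<close>, \<open>red_fun\<close>
  forces it to be \<open>ured k\<close>, which unfolds to reducibility at level
  \<open>k\<close>.\<close>

lemma valid_type:
  assumes "valid \<Gamma> A B (univ k)" "sem_sub \<Gamma> \<sigma> \<sigma>'"
  obtains R where "red k (subst \<sigma> A) (subst \<sigma>' B) R"
proof -
  obtain l R where R: "red l (univ k) (univ k) R" "R (subst \<sigma> A) (subst \<sigma>' B)"
    using validE[OF assms] by auto
  have "R = ured k" using red_fun[OF red_univ R(1)] .
  then show ?thesis using R(2) ured_iff that by blast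
qed

lemma validI_type:
  assumes "\<And>\<sigma> \<sigma>'. sem_sub \<Gamma> \<sigma> \<sigma>' \<Longrightarrow> \<exists>R. red k (subst \<sigma> A) (subst \<sigma>' B) R"
  shows "valid \<Gamma> A B (univ k)"
  unfolding valid_def
proof (intro allI impI)
  fix \<sigma> \<sigma>'
  assume "sem_sub \<Gamma> \<sigma> \<sigma>'"
  then have "ured k (subst \<sigma> A) (subst \<sigma>' B)"
    by (rule ured_iff[THEN iffD2, OF assms])
  then show "\<exists>l R. red l (subst \<sigma> (univ k)) (subst \<sigma>' (univ k)) R \<and> R (subst \<sigma> A) (subst \<sigma>' B)"
    using red_univ by auto
qed

section \<open>Validity of the structural rules\<close>

lemma valid_sym: "\<turnstile> \<Gamma> \<Longrightarrow> valid \<Gamma> t t' T \<Longrightarrow> valid \<Gamma> t' t T"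
  unfolding valid_def
proof (intro allI impI)
  fix \<sigma> \<sigma>'
  assume \<Gamma>: "\<turnstile> \<Gamma>" and v: "\<forall>\<sigma> \<sigma>'. sem_sub \<Gamma> \<sigma> \<sigma>' \<longrightarrow>
    (\<exists>k R. red k (subst \<sigma> T) (subst \<sigma>' T) R \<and> R (subst \<sigma> t) (subst \<sigma>' t'))" and \<sigma>: "sem_sub \<Gamma> \<sigma> \<sigma>'"
  obtain k R where "red k (subst \<sigma>' T) (subst \<sigma> T) R" "R (subst \<sigma>' t) (subst \<sigma> t')"
    using v sem_sub_sym[OF \<Gamma> \<sigma>] by blast
  then show "\<exists>k R. red k (subst \<sigma> T) (subst \<sigma>' T) R \<and> R (subst \<sigma> t') (subst \<sigma>' t)"
    using red_sym cand_sym[OF red_cand] by blast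
qed

text \<open>The first equality is used at \<open>\<sigma>\<close>, \<open>\<sigma>\<close> and the
  second at \<open>\<sigma>\<close>, \<open>\<sigma>'\<close>: both relations then start from the
  same instance of \<open>T\<close> and coincide.\<close>

lemma valid_trans:
  assumes "valid \<Gamma> t1 t2 T" "valid \<Gamma> t2 t3 T"
  shows "valid \<Gamma> t1 t3 T"
  unfolding valid_def
proof (intro allI impI)
  fix \<sigma> \<sigma>'
  assume \<sigma>: "sem_sub \<Gamma> \<sigma> \<sigma>'"
  obtain k R where 1: "red k (subst \<sigma> T) (subst \<sigma> T) R" "R (subst \<sigma> t1) (subst \<sigma> t2)"
    using validE[OF assms(1) sem_sub_refl[OF \<sigma>]] .
  obtain k' R' where 2: "red k' (subst \<sigma> T) (subst \<sigma>' T) R'" "R' (subst \<sigma> t2) (subst \<sigma>' t3)"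
    using validE[OF assms(2) \<sigma>] .
  have "R' = R" using red_fun[OF 1(1) 2(1)] .
  then have "R' (subst \<sigma> t1) (subst \<sigma>' t3)"
    using cand_trans[OF red_cand[OF 2(1)] _ 2(2)] 1(2) by simp
  then show "\<exists>k R. red k (subst \<sigma> T) (subst \<sigma>' T) R \<and> R (subst \<sigma> t1) (subst \<sigma>' t3)"
    using 2(1) by blast
qed

lemma valid_refl: "\<turnstile> \<Gamma> \<Longrightarrow> valid \<Gamma> t t' T \<Longrightarrow> valid \<Gamma> t t T"
  by (rule valid_trans[OF _ valid_sym])

lemma valid_conv:
  assumes t: "valid \<Gamma> t t' T" and T: "valid \<Gamma> T T' (univ j)"
  shows "valid \<Gamma> t t' T'"
  unfolding valid_def
proof (intro allI impI)
  fix \<sigma> \<sigma>'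
  assume \<sigma>: "sem_sub \<Gamma> \<sigma> \<sigma>'"
  obtain k R where R: "red k (subst \<sigma> T) (subst \<sigma>' T) R" "R (subst \<sigma> t) (subst \<sigma>' t')"
    using validE[OF t \<sigma>] .
  obtain R1 where R1: "red j (subst \<sigma> T) (subst \<sigma>' T') R1" using valid_type[OF T \<sigma>] .
  obtain R2 where R2: "red j (subst \<sigma> T) (subst \<sigma> T') R2"
    using valid_type[OF T sem_sub_refl[OF \<sigma>]] .
  have "red j (subst \<sigma> T') (subst \<sigma>' T') R2" using red_trans[OF red_sym[OF R2] R1] .
  moreover have "R2 = R" using red_fun[OF R(1) R2] .
  ultimately show "\<exists>k R. red k (subst \<sigma> T') (subst \<sigma>' T') R \<and> R (subst \<sigma> t) (subst \<sigma>' t')"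
    using R(2) by blast
qed

section \<open>Validity of the rules for functions\<close>

lemma pi_whe: "Pi r U s s' T \<Down> Pi r U s s' T"
  by (rule whe_whnf) (rule whnf.intros)

lemma red_pi_inv:
  assumes "red k (Pi r U s s' T) (Pi r U' s s' T') R"
  obtains i RU j RT where "red i U U' RU"
    "\<forall>u u'. arg r U RU u u' \<longrightarrow> red j (T\<langle>u\<rangle>) (T'\<langle>u'\<rangle>) (RT u)"
    "R = pi_rel (Pi r U s s' T) r U RU RT"
proof (rule LR_pi_inv[OF assms pi_whe])
  fix i j U'' T'' RU RT
  assume "Pi r U' s s' T' \<Down> Pi r U'' s s' T''"
  then have [simp]: "U'' = U'" "T'' = T'" using whe_det(1)[OF pi_whe] by blast+
  assume "red i U U'' RU" "\<And>u u'. arg r U RU u u' \<Longrightarrow> red j (T\<langle>u\<rangle>) (T''\<langle>u'\<rangle>) (RT u)"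
    "R = pi_rel (Pi r U s s' T) r U RU RT"
  then show ?thesis by (intro that[of i RU j RT]) simp_all
qed

text \<open>The semantic premises cover only instances of the codomains in \<open>D\<close>. The
  equality of the function types themselves is obtained from the hypothesis \<open>eq\<close> by
  functionality.\<close>

lemma valid_pi:
  assumes \<Gamma>: "\<turnstile> \<Gamma>" and U: "valid \<Gamma> U U' (Sort s1)" and T: "valid ((r, U) # \<Gamma>) T T' (Sort s2)"
    and s3: "(s1, s2, s3) \<in> Rule" and eq: "\<Gamma> \<turnstile> Pi r U s1 s2 T = Pi r U' s1 s2 T' : Sort s3"
  shows "valid \<Gamma> (Pi r U s1 s2 T) (Pi r U' s1 s2 T') (Sort s3)"
proof -
  obtain i j where s: "s1 = Set i" "s2 = Set j" "s3 = Set (max i j)"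
    using s3 by (auto simp: Rule_def)
  show ?thesis
    unfolding s
  proof (rule validI_type)
    fix \<sigma> \<sigma>'
    assume \<sigma>: "sem_sub \<Gamma> \<sigma> \<sigma>'"
    obtain RU where RU: "red i (subst \<sigma> U) (subst \<sigma>' U') RU"
      using valid_type[OF U[unfolded s] \<sigma>] .
    \<comment> \<open>The environment for the codomain needs \<open>U\<close> under both
      substitutions, while the function types compare \<open>U\<close> with \<open>U'\<close>; the
      relation is the same.\<close>
    obtain RU' where RU': "red i (subst \<sigma> U) (subst \<sigma>' U) RU'"
      using valid_type[OF valid_refl[OF \<Gamma> U, unfolded s] \<sigma>] .
    have "RU' = RU" using red_fun[OF RU RU'] .
    note RU' = RU'[unfolded this]
    let ?T = "subst (up_subst \<sigma>) T" and ?T' = "subst (up_subst \<sigma>') T'"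
    \<comment> \<open>The premise gives some relation for each argument, but \<open>LR_pi\<close>
      wants a family. Any choice is right, because \<open>red_fun\<close> makes the relation of
      \<open>?T\<langle>u\<rangle>\<close> unique.\<close>
    define RT where "RT u = (SOME R. \<exists>B. red j (?T\<langle>u\<rangle>) B R)" for u
    have RT: "red j (?T\<langle>u\<rangle>) (?T'\<langle>u'\<rangle>) (RT u)" if u: "arg r (subst \<sigma> U) RU u u'" for u u'
    proof -
      have "sem_sub ((r, U) # \<Gamma>) (case_nat u \<sigma>) (case_nat u' \<sigma>')"
        unfolding sem_sub_case_nat using \<sigma> arg_sem_arg[OF RU' u] by simp
      from valid_type[OF T[unfolded s] this] obtain R where R: "red j (?T\<langle>u\<rangle>) (?T'\<langle>u'\<rangle>) R"
        unfolding subst_up_subst1 by blast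
      then have "\<exists>B. red j (?T\<langle>u\<rangle>) B (RT u)"
        unfolding RT_def by (rule someI_ex[of "\<lambda>R. \<exists>B. red j (?T\<langle>u\<rangle>) B R", OF exI, OF exI])
      then obtain B where "red j (?T\<langle>u\<rangle>) B (RT u)" ..
      from red_fun[OF this R] show ?thesis using R by simp
    qed
    have P: "D \<turnstile> Pi r (subst \<sigma> U) (Set i) (Set j) ?T = Pi r (subst \<sigma>' U') (Set i) (Set j) ?T' : univ (max i j)"
      using functionality_eq[OF wf_D sem_sub_eq_sub[OF \<sigma>] eq] unfolding s by simp
    show "\<exists>R. red (max i j) (subst \<sigma> (Pi r U (Set i) (Set j) T)) (subst \<sigma>' (Pi r U' (Set i) (Set j) T')) R"
      unfolding subst.simps
      by (rule exI, rule LR_pi[OF pi_whe pi_whe eq_refl eq_refl P RU RT])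
        (use eq_typed[OF P] in simp_all)
  qed
qed

lemma valid_app:
  assumes \<Gamma>: "\<turnstile> \<Gamma>" and t: "valid \<Gamma> t t' (Pi r U s s' T)"
    and rel: "r = Rel \<Longrightarrow> valid \<Gamma> u u' U"
    and irr: "r = Irr \<Longrightarrow> \<Gamma>\<^sup>\<oplus> \<turnstile> u : U" "r = Irr \<Longrightarrow> \<Gamma>\<^sup>\<oplus> \<turnstile> u' : U"
  shows "valid \<Gamma> (App r t u) (App r t' u') (T\<langle>u\<rangle>)"
  unfolding valid_def
proof (intro allI impI)
  fix \<sigma> \<sigma>'
  assume \<sigma>: "sem_sub \<Gamma> \<sigma> \<sigma>'"
  obtain k R where R: "red k (subst \<sigma> (Pi r U s s' T)) (subst \<sigma>' (Pi r U s s' T)) R"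
    and tt: "R (subst \<sigma> t) (subst \<sigma>' t')"
    using validE[OF t \<sigma>] .
  obtain i RU j RT where RU: "red i (subst \<sigma> U) (subst \<sigma>' U) RU"
    and RT0: "\<forall>v v'. arg r (subst \<sigma> U) RU v v' \<longrightarrow>
      red j ((subst (up_subst \<sigma>) T)\<langle>v\<rangle>) ((subst (up_subst \<sigma>') T)\<langle>v'\<rangle>) (RT v)"
    and R': "R = pi_rel (Pi r (subst \<sigma> U) s s' (subst (up_subst \<sigma>) T)) r (subst \<sigma> U) RU RT"
    using red_pi_inv[OF R[unfolded subst.simps]] .
  note RT = RT0[rule_format]
  have arg: "arg r (subst \<sigma> U) RU (subst \<sigma> u) (subst \<sigma>' v)"
    if v: "r = Rel \<Longrightarrow> valid \<Gamma> u v U" "r = Irr \<Longrightarrow> \<Gamma>\<^sup>\<oplus> \<turnstile> v : U" for v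
  proof (cases r)
    case Rel
    obtain k' R1 where R1: "red k' (subst \<sigma> U) (subst \<sigma>' U) R1" "R1 (subst \<sigma> u) (subst \<sigma>' v)"
      using validE[OF v(1)[OF Rel] \<sigma>] .
    have "R1 = RU" using red_fun[OF RU R1(1)] .
    then show ?thesis using R1(2) Rel by (simp add: arg_def)
  next
    case Irr
    have ok: "sub_ok (D\<^sup>\<oplus>) \<sigma> (\<Gamma>\<^sup>\<oplus>)" "sub_ok (D\<^sup>\<oplus>) \<sigma>' (\<Gamma>\<^sup>\<oplus>)"
      using substitution.ok_ann[OF sem_sub_functionality(1)[OF \<Gamma> \<sigma>], of Irr]
        substitution.ok_ann[OF sem_sub_functionality(2)[OF \<Gamma> \<sigma>], of Irr] by simp_all
    have wf: "\<turnstile> D\<^sup>\<oplus>" using upgrade_wf_ann[OF wf_D, of Irr] by simp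
    have "D\<^sup>\<oplus> \<turnstile> subst \<sigma>' U = subst \<sigma> U : univ i"
      using ann_ctx_eq[OF eq_sym[OF LR_eq[OF RU]], of Irr] by simp
    then show ?thesis
      using substitution.typing[OF irr(1)[OF Irr] wf ok(1)]
        ty_conv[OF substitution.typing[OF v(2)[OF Irr] wf ok(2)]] Irr by (simp add: arg_def)
  qed
  have "arg r (subst \<sigma> U) RU (subst \<sigma> u) (subst \<sigma>' u')"
    by (rule arg) (fact rel, fact irr(2))
  then have "RT (subst \<sigma> u) (subst \<sigma> (App r t u)) (subst \<sigma>' (App r t' u'))"
    using tt unfolding R' pi_rel_def subst.simps by blast
  \<comment> \<open>The type has \<open>u\<close> on both sides, the terms have \<open>u\<close> and
    \<open>u'\<close>. Since \<open>RT\<close> is indexed by the left argument, one relation serves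
    both.\<close>
  moreover have "arg r (subst \<sigma> U) RU (subst \<sigma> u) (subst \<sigma>' u)"
    by (rule arg) (erule valid_refl[OF \<Gamma> rel], fact irr(1))
  note RT[OF this]
  ultimately show "\<exists>k R. red k (subst \<sigma> (T\<langle>u\<rangle>)) (subst \<sigma>' (T\<langle>u\<rangle>)) R \<and>
      R (subst \<sigma> (App r t u)) (subst \<sigma>' (App r t' u'))"
    unfolding subst_subst1_up by blast
qed

lemma lam_WN: "D \<turnstile> Lam r U t : A \<Longrightarrow> WN A (Lam r U t)"
  unfolding WN_def by (rule exI[of _ "Lam r U t"]) (simp add: whe_whnf whnf.intros eq_refl)

text \<open>Applied to related arguments, the two abstractions are head expansions of bodies related
  in the extended environment. \<open>t'\<close> is asked over \<open>U'\<close> because \<beta> on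
  the right reduces an abstraction with that domain.\<close>

lemma valid_lam:
  assumes P: "valid \<Gamma> (Pi r U s1 s2 T) (Pi r U s1 s2 T) (Sort s3)"
    and v: "valid ((r, U) # \<Gamma>) t t' T"
    and U: "\<Gamma> \<turnstile> U = U' : Sort s1" and t: "(r, U) # \<Gamma> \<turnstile> t : T" and t': "(r, U') # \<Gamma> \<turnstile> t' : T"
    and eq: "\<Gamma> \<turnstile> Lam r U t = Lam r U' t' : Pi r U s1 s2 T"
  shows "valid \<Gamma> (Lam r U t) (Lam r U' t') (Pi r U s1 s2 T)"
  unfolding valid_def
proof (intro allI impI)
  fix \<sigma> \<sigma>'
  assume \<sigma>: "sem_sub \<Gamma> \<sigma> \<sigma>'"
  obtain k where s3: "s3 = Set k" by (cases s3)
  have \<Gamma>: "\<turnstile> \<Gamma>" using typing_wf(3)[OF U] .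
  let ?T = "subst (up_subst \<sigma>) T" and ?T' = "subst (up_subst \<sigma>') T"
  let ?t = "subst (up_subst \<sigma>) t" and ?t' = "subst (up_subst \<sigma>') t'"
  let ?U = "subst \<sigma> U" and ?U' = "subst \<sigma>' U'"
  obtain R where R: "red k (Pi r ?U s1 s2 ?T) (Pi r (subst \<sigma>' U) s1 s2 ?T') R"
    using valid_type[OF P[unfolded s3] \<sigma>] by auto
  obtain i RU j RT where RU: "red i ?U (subst \<sigma>' U) RU"
    and RT0: "\<forall>v v'. arg r ?U RU v v' \<longrightarrow> red j (?T\<langle>v\<rangle>) (?T'\<langle>v'\<rangle>) (RT v)"
    and R': "R = pi_rel (Pi r ?U s1 s2 ?T) r ?U RU RT"
    using red_pi_inv[OF R] .
  note RT = RT0[rule_format]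
  have E: "D \<turnstile> Lam r ?U ?t = Lam r ?U' ?t' : Pi r ?U s1 s2 ?T"
    using functionality_eq[OF wf_D sem_sub_eq_sub[OF \<sigma>] eq] by simp
  have UU: "D \<turnstile> ?U = ?U' : Sort s1"
    using functionality_eq[OF wf_D sem_sub_eq_sub[OF \<sigma>] U] by simp
  have wf: "\<turnstile> (r, ?U) # D" "\<turnstile> (r, ?U') # D"
    using wf_ext[OF wf_D] eq_typed[OF UU] by blast+
  note ok = sem_sub_functionality[OF \<Gamma> \<sigma>]
  have tD: "(r, ?U) # D \<turnstile> ?t : ?T"
    using substitution.typing[OF t wf(1) sub_ok_up[OF wf(1) ok(1)]] .
  have tD': "(r, ?U') # D \<turnstile> ?t' : ?T'"
    using substitution.typing[OF t' wf(2) sub_ok_up[OF wf(2) ok(2)]] .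
  have "RT u (App r (Lam r ?U ?t) u) (App r (Lam r ?U' ?t') u')" if u: "arg r ?U RU u u'" for u u'
  proof -
    have "sem_sub ((r, U) # \<Gamma>) (case_nat u \<sigma>) (case_nat u' \<sigma>')"
      unfolding sem_sub_case_nat using \<sigma> arg_sem_arg[OF RU u] by simp
    from validE[OF v this] obtain k' R1 where
      R1: "red k' (?T\<langle>u\<rangle>) (?T'\<langle>u'\<rangle>) R1" "R1 (?t\<langle>u\<rangle>) (?t'\<langle>u'\<rangle>)"
      unfolding subst_up_subst1 by blast
    have R1': "R1 = RT u" using red_fun[OF RT[OF u] R1(1)] .
    have u1: "ann_ctx r D \<turnstile> u : ?U" and "ann_ctx r D \<turnstile> u' : ?U"
      using arg_typed[OF red_cand[OF RU] u] by blast+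
    then have u2: "ann_ctx r D \<turnstile> u' : ?U'" using ty_conv[OF _ ann_ctx_eq[OF UU]] by blast
    have "R1 (App r (Lam r ?U ?t) u) (?t'\<langle>u'\<rangle>)"
      by (rule expand_left[OF R1 whe_beta eq_beta[OF tD u1]])
    from expand_right[OF R1(1) this whe_beta eq_beta[OF tD' u2]]
    show ?thesis unfolding R1' .
  qed
  then have "R (Lam r ?U ?t) (Lam r ?U' ?t')"
    unfolding R' pi_rel_def using E lam_WN eq_typed[OF E] by blast
  then show "\<exists>k R. red k (subst \<sigma> (Pi r U s1 s2 T)) (subst \<sigma>' (Pi r U s1 s2 T)) R \<and>
      R (subst \<sigma> (Lam r U t)) (subst \<sigma>' (Lam r U' t'))"
    using R by auto
qed

text \<open>The right-hand side is \<open>t\<close> in the environment extended by the instances of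
  \<open>u\<close>; the redex is a head expansion of it on the left.\<close>

lemma valid_beta:
  assumes v: "valid ((r, U) # \<Gamma>) t t T" and t: "(r, U) # \<Gamma> \<turnstile> t : T"
    and u: "ann_ctx r \<Gamma> \<turnstile> u : U" and rel: "r = Rel \<Longrightarrow> valid \<Gamma> u u U"
  shows "valid \<Gamma> (App r (Lam r U t) u) (t\<langle>u\<rangle>) (T\<langle>u\<rangle>)"
  unfolding valid_def
proof (intro allI impI)
  fix \<sigma> \<sigma>'
  assume \<sigma>: "sem_sub \<Gamma> \<sigma> \<sigma>'"
  have \<Gamma>: "\<turnstile> \<Gamma>" and "\<exists>s. \<Gamma> \<turnstile> U : Sort s" using wf_ConsD[OF typing_wf(2)[OF t]] by blast+
  then obtain s where U: "\<Gamma> \<turnstile> U : Sort s" by blast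
  note ok = sem_sub_functionality[OF \<Gamma> \<sigma>]
  have UU: "D \<turnstile> subst \<sigma> U = subst \<sigma>' U : Sort s" using ok(3)[OF U] by simp
  have u1: "ann_ctx r D \<turnstile> subst \<sigma> u : subst \<sigma> U"
    using substitution.typing[OF u upgrade_wf_ann[OF wf_D] substitution.ok_ann[OF ok(1)]] .
  have "sem_arg r (subst \<sigma> U) (subst \<sigma>' U) (subst \<sigma> u) (subst \<sigma>' u)"
  proof (cases r)
    case Rel
    obtain k R where "red k (subst \<sigma> U) (subst \<sigma>' U) R" "R (subst \<sigma> u) (subst \<sigma>' u)"
      using validE[OF rel[OF Rel] \<sigma>] .
    then show ?thesis using Rel by (auto simp: sem_arg_def)
  next
    case Irr
    have "ann_ctx r D \<turnstile> subst \<sigma>' u : subst \<sigma> U"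
      using ty_conv[OF substitution.typing[OF u upgrade_wf_ann[OF wf_D] substitution.ok_ann[OF ok(2)]]
          ann_ctx_eq[OF eq_sym[OF UU]]] .
    then show ?thesis using u1 Irr by (simp add: sem_arg_def)
  qed
  then have "sem_sub ((r, U) # \<Gamma>) (case_nat (subst \<sigma> u) \<sigma>) (case_nat (subst \<sigma>' u) \<sigma>')"
    unfolding sem_sub_case_nat using \<sigma> by simp
  from validE[OF v this] obtain k R where
    R: "red k (subst \<sigma> (T\<langle>u\<rangle>)) (subst \<sigma>' (T\<langle>u\<rangle>)) R" "R (subst \<sigma> (t\<langle>u\<rangle>)) (subst \<sigma>' (t\<langle>u\<rangle>))"
    unfolding subst_subst1 by blast
  have wf: "\<turnstile> (r, subst \<sigma> U) # D" using wf_ext[OF wf_D] eq_typed[OF UU] by blast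
  have tD: "(r, subst \<sigma> U) # D \<turnstile> subst (up_subst \<sigma>) t : subst (up_subst \<sigma>) T"
    using substitution.typing[OF t wf sub_ok_up[OF wf ok(1)]] .
  have "R (subst \<sigma> (App r (Lam r U t) u)) (subst \<sigma>' (t\<langle>u\<rangle>))"
    using expand_left[OF R[unfolded subst_subst1_up] whe_beta eq_beta[OF tD u1]]
    unfolding subst_subst1_up subst.simps .
  then show "\<exists>k R. red k (subst \<sigma> (T\<langle>u\<rangle>)) (subst \<sigma>' (T\<langle>u\<rangle>)) R \<and>
      R (subst \<sigma> (App r (Lam r U t) u)) (subst \<sigma>' (t\<langle>u\<rangle>))"
    using R(1) by blast
qed

text \<open>An applied \<eta>-expansion evaluates as \<open>t\<close> applied to the same argument,
  so \<open>expand_right\<close> reduces the claim to reducibility of \<open>t\<close>.\<close>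

lemma valid_eta:
  assumes v: "valid \<Gamma> t t (Pi r U s s' T)" and t: "\<Gamma> \<turnstile> t : Pi r U s s' T"
  shows "valid \<Gamma> t (Lam r U (App r (wk 1 t) (Var 0))) (Pi r U s s' T)"
  unfolding valid_def
proof (intro allI impI)
  fix \<sigma> \<sigma>'
  assume \<sigma>: "sem_sub \<Gamma> \<sigma> \<sigma>'"
  let ?T = "subst (up_subst \<sigma>) T" and ?T' = "subst (up_subst \<sigma>') T"
  let ?U = "subst \<sigma> U" and ?U' = "subst \<sigma>' U"
  let ?L = "Lam r ?U' (App r (wk 1 (subst \<sigma>' t)) (Var 0))"
  have L: "subst \<sigma>' (Lam r U (App r (wk 1 t) (Var 0))) = ?L"
    by (simp only: subst.simps subst_up_wk up_subst.simps)
  note ok = sem_sub_functionality[OF typing_wf(2)[OF t] \<sigma>]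
  have t': "D \<turnstile> subst \<sigma>' t : Pi r ?U' s s' ?T'"
    using substitution.typing[OF t wf_D ok(2)] by simp
  obtain k R where R: "red k (Pi r ?U s s' ?T) (Pi r ?U' s s' ?T') R" "R (subst \<sigma> t) (subst \<sigma>' t)"
    using validE[OF v \<sigma>] by auto
  obtain i RU j RT where RU: "red i ?U ?U' RU"
    and RT0: "\<forall>v v'. arg r ?U RU v v' \<longrightarrow> red j (?T\<langle>v\<rangle>) (?T'\<langle>v'\<rangle>) (RT v)"
    and R': "R = pi_rel (Pi r ?U s s' ?T) r ?U RU RT"
    using red_pi_inv[OF R(1)] .
  note RT = RT0[rule_format]
  have E: "D \<turnstile> subst \<sigma> t = ?L : Pi r ?U s s' ?T"
    using functionality_eq[OF wf_D sem_sub_eq_sub[OF \<sigma>] eq_eta[OF t]] unfolding L by simp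
  have "RT u (App r (subst \<sigma> t) u) (App r ?L u')" if u: "arg r ?U RU u u'" for u u'
  proof -
    have tt: "RT u (App r (subst \<sigma> t) u) (App r (subst \<sigma>' t) u')"
      using R(2) u unfolding R' pi_rel_def by blast
    have "(App r (wk 1 (subst \<sigma>' t)) (Var 0))\<langle>u'\<rangle> = App r (subst \<sigma>' t) u'"
      by (simp add: subst1_eq subst_rename comp_def subst_Var)
    then have whe: "App r ?L u' \<Down> v" if "App r (subst \<sigma>' t) u' \<Down> v" for v
      using whe_beta that by metis
    have "ann_ctx r D \<turnstile> u' : ?U" using arg_typed[OF red_cand[OF RU] u] by blast
    then have u': "ann_ctx r D \<turnstile> u' : ?U'" using ty_conv[OF _ ann_ctx_eq[OF LR_eq[OF RU]]] by blast
    \<comment> \<open>Taken from \<eta> by congruence instead of from \<beta>, so the body under the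
      binder need not be typed here.\<close>
    have "D \<turnstile> App r ?L u' = App r (subst \<sigma>' t) u' : ?T'\<langle>u'\<rangle>"
      by (rule eq_app[OF eq_sym[OF eq_eta[OF t']]]) (use u' eq_refl in auto)
    from expand_right[OF RT[OF u] tt whe this] show ?thesis .
  qed
  then have "R (subst \<sigma> t) ?L"
    using R(2) lam_WN E eq_typed[OF E] unfolding R' pi_rel_def by blast
  then show "\<exists>k R. red k (subst \<sigma> (Pi r U s s' T)) (subst \<sigma>' (Pi r U s s' T)) R \<and>
      R (subst \<sigma> t) (subst \<sigma>' (Lam r U (App r (wk 1 t) (Var 0))))"
    using R(1) unfolding L by auto
qed

lemma fundamental:
  "\<turnstile> \<Gamma> \<Longrightarrow> True"
  "\<Gamma> \<turnstile> t : T \<Longrightarrow> valid \<Gamma> t t T"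
  "\<Gamma> \<turnstile> t = t' : T \<Longrightarrow> valid \<Gamma> t t' T"
proof (induction rule: wf_ctx_has_type_eq_type.inducts)
  case (ty_sort \<Gamma> s s')
  then obtain k where s: "s = Set k" "s' = Set (Suc k)" by (auto simp: Axiom_def)
  show ?case unfolding s by (rule validI_type) (use red_univ in auto)
next
  case (ty_pi \<Gamma> U s1 r T s2 s3)
  show ?case
    by (rule valid_pi[OF typing_wf(2)[OF ty_pi.hyps(1)] ty_pi.IH ty_pi.hyps(3)
          eq_refl[OF wf_ctx_has_type_eq_type.ty_pi[OF ty_pi.hyps]]])
next
  case (ty_var \<Gamma> i U)
  show ?case unfolding valid_def subst_wk subst.simps
    using sem_sub_nth[OF _ ty_var.hyps(2,3)] by blast
next
  case (ty_lam r U \<Gamma> t T s s' s'')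
  show ?case
    by (rule valid_lam[OF ty_lam.IH(2,1) eq_refl[OF pi_inv(1)[OF ty_lam.hyps(2)]] ty_lam.hyps(1,1)
          eq_refl[OF wf_ctx_has_type_eq_type.ty_lam[OF ty_lam.hyps]]])
next
  case (ty_app \<Gamma> t r U s s' T u)
  show ?case
    by (rule valid_app[OF typing_wf(2)[OF ty_app.hyps(1)] ty_app.IH(1)]) (use ty_app in auto)
next
  case (ty_conv \<Gamma> t T T' s)
  then show ?case by (cases s) (auto intro: valid_conv)
next
  case (eq_beta r U \<Gamma> t T u)
  show ?case by (rule valid_beta[OF eq_beta.IH(1) eq_beta.hyps]) (use eq_beta.IH(2) in simp)
next
  case (eq_eta \<Gamma> t r U s s' T)
  show ?case by (rule valid_eta[OF eq_eta.IH eq_eta.hyps])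
next
  case (eq_sym \<Gamma> t t' T)
  show ?case by (rule valid_sym[OF typing_wf(3)[OF eq_sym.hyps] eq_sym.IH])
next
  case (eq_trans \<Gamma> t1 t2 T t3)
  show ?case by (rule valid_trans[OF eq_trans.IH])
next
  case (eq_pi \<Gamma> U U' s1 r T T' s2 s3)
  show ?case
    by (rule valid_pi[OF typing_wf(3)[OF eq_pi.hyps(1)] eq_pi.IH eq_pi.hyps(3)
          wf_ctx_has_type_eq_type.eq_pi[OF eq_pi.hyps]])
next
  case (eq_lam \<Gamma> U U' s1 r T s2 t t')
  obtain s3 where s3: "(s1, s2, s3) \<in> Rule" using Rule_ex by blast
  have \<Gamma>: "\<turnstile> \<Gamma>" using typing_wf(3)[OF eq_lam.hyps(1)] .
  have U: "\<Gamma> \<turnstile> U : Sort s1" "\<Gamma> \<turnstile> U' : Sort s1"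
    using syntactic_validity(3)[OF eq_lam.hyps(1)] by blast+
  have t: "(r, U) # \<Gamma> \<turnstile> t : T" "(r, U) # \<Gamma> \<turnstile> t' : T"
    using syntactic_validity(3)[OF eq_lam.hyps(3)] by blast+
  \<comment> \<open>\<open>eq_lam\<close> has no premise for the function type, so its validity is
    assembled from that of \<open>U\<close> and \<open>T\<close>.\<close>
  have P: "valid \<Gamma> (Pi r U s1 s2 T) (Pi r U s1 s2 T) (Sort s3)"
    by (rule valid_pi[OF \<Gamma> valid_refl[OF \<Gamma> eq_lam.IH(1)] eq_lam.IH(2) s3
          eq_refl[OF ty_pi[OF U(1) eq_lam.hyps(2) s3]]])
  show ?case
    by (rule valid_lam[OF P eq_lam.IH(3) eq_lam.hyps(1) t(1)
          ctx_conversion[OF U(2) eq_lam.hyps(1) t(2)] wf_ctx_has_type_eq_type.eq_lam[OF eq_lam.hyps]])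
next
  case (eq_app_rel \<Gamma> t t' U s s' T u u')
  show ?case
    by (rule valid_app[OF typing_wf(3)[OF eq_app_rel.hyps(1)] eq_app_rel.IH(1)])
      (use eq_app_rel in auto)
next
  case (eq_app_irr \<Gamma> t t' U s s' T u u')
  show ?case
    by (rule valid_app[OF typing_wf(3)[OF eq_app_irr.hyps(1)] eq_app_irr.IH(1)])
      (use eq_app_irr in auto)
next
  case (eq_conv \<Gamma> t t' T T' s)
  then show ?case by (cases s) (auto intro: valid_conv)
qed simp_all

section \<open>The identity environment\<close>

lemma wf_ctx_append: "\<turnstile> \<Xi> @ \<Gamma> \<Longrightarrow> \<turnstile> \<Gamma>"
  by (induction \<Xi>) (auto dest: wf_ConsD)

text \<open>Each type of \<open>D\<close> lives in a suffix of \<open>D\<close>, where the identity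
  becomes the shift by \<open>length \<Xi>\<close>; hence the induction runs over suffixes. The
  fundamental lemma makes the type reducible, and its variable is then reducible as a neutral term,
  or merely typed if irrelevant.\<close>

lemma sem_sub_suffix: "D = \<Xi> @ \<Gamma> \<Longrightarrow>
    sem_sub \<Gamma> (\<lambda>i. Var (i + length \<Xi>)) (\<lambda>i. Var (i + length \<Xi>))"
proof (induction \<Gamma> arbitrary: \<Xi>)
  case (Cons b \<Gamma>)
  obtain r U where b: "b = (r, U)" by (cases b)
  let ?n = "length \<Xi>"
  let ?\<sigma> = "\<lambda>i. Var (i + Suc ?n)"
  have \<sigma>: "sem_sub \<Gamma> ?\<sigma> ?\<sigma>" using Cons.IH[of "\<Xi> @ [b]"] Cons.prems by simp
  have "\<turnstile> (r, U) # \<Gamma>" using wf_ctx_append[of \<Xi>] wf_D Cons.prems b by simp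
  then obtain k where U: "\<Gamma> \<turnstile> U : univ k" by (metis wf_ConsD usort.exhaust)
  obtain R where R: "red k (subst ?\<sigma> U) (subst ?\<sigma> U) R"
    using valid_type[OF fundamental(2)[OF U] \<sigma>] .
  have n: "?n < length D" "D ! ?n = (r, U)" using Cons.prems b by simp_all
  have "ann_ctx r D \<turnstile> Var ?n : wk (Suc ?n) U"
    using sub_ok_Var[OF wf_D] n unfolding sub_ok_def subst_Var by fastforce
  then have v: "ann_ctx r D \<turnstile> Var ?n : subst ?\<sigma> U" by (simp add: rename_eq_subst comp_def)
  have "sem_arg r (subst ?\<sigma> U) (subst ?\<sigma> U) (Var ?n) (Var ?n)"
  proof (cases r)
    case Rel
    have "R (Var ?n) (Var ?n)"
      using cand_neutral[OF red_cand[OF R] neutral.intros(1) neutral.intros(1)] v Rel eq_refl by simp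
    then show ?thesis using R Rel by (auto simp: sem_arg_def)
  next
    case Irr
    then show ?thesis using v by (simp add: sem_arg_def)
  qed
  then show ?case using \<sigma> by (simp add: b comp_def)
qed simp

lemma weak_head_normalization:
  assumes "D \<turnstile> t : T"
  shows "WN T t"
proof -
  have "sem_sub D Var Var" using sem_sub_suffix[of "[]" D] by simp
  from validE[OF fundamental(2)[OF assms] this] obtain k R where "red k T T R" "R t t"
    unfolding subst_Var by blast
  then show ?thesis using cand_WN[OF red_cand] by blast
qed

end

theorem theorem5p9:
  fixes \<Gamma> :: ctx and t T :: expr
  assumes "\<Gamma> \<turnstile> t : T"
  shows "\<exists>a. whnf a \<and> t \<Down> a \<and> \<Gamma> \<turnstile> t = a : T"
proof -
  interpret target \<Gamma> by unfold_locales (rule typing_wf(2)[OF assms])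
  show ?thesis using weak_head_normalization[OF assms] unfolding WN_def .
qed

end
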